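(* There exist a smooth, proper fibration $p:X\to Y$ between Kähler manifolds such that $c_1(X_y)=0$ for all $y\in Y$ (where $X_y=p^{-1}(y)$), and a Kähler form $\omega$ on $X$, such that the relative Ricci-flat metric $\theta_{\rm KE}\in[\omega]$ is not semipositive.
   Context: Let $n$ be the relative dimension of $p$ and $\omega_y:=\omega|_{X_y}$. For each $y\in Y$, by Yau's theorem there is a unique smooth function $\varphi_y$ on $X_y$ such that $\theta_y:=\omega_y+dd^c\varphi_y$ is a Kähler form with $\mathrm{Ric}\,\theta_y=0$ and $\int_{X_y}\varphi_y\,\omega_y^n=0$. The function $\varphi$ on $X$ defined by $\varphi|_{X_y}=\varphi_y$ is smooth, and the relative Ricci-flat metric in $[\omega]$ is the smooth closed $(1,1)$-form $\theta_{\rm KE}:=\omega+dd^c\varphi$ on $X$. *)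

theory Defs
  imports "HOL-Analysis.Analysis" "HOL-Combinatorics.Permutations"
begin

section \<open>Calculus on complex number space\<close>

text \<open>
  Complex \<open>m\<close>-space is the set \<open>Csp m\<close> of sequences vanishing from index \<open>m\<close> on.  The dimension is
  thus a number rather than a type and can be quantified over.  The product topology on the type of
  all sequences induces the Euclidean topology on \<open>Csp m\<close>.
\<close>

type_synonym cvec = "nat \<Rightarrow> complex"

definition Csp :: "nat \<Rightarrow> cvec set" where
  "Csp m = {z. \<forall>i\<ge>m. z i = 0}"

definition cunit :: "nat \<Rightarrow> cvec" where
  "cunit j = (\<lambda>i. if i = j then 1 else 0)"

definition Jop :: "cvec \<Rightarrow> cvec" where
  "Jop v = (\<lambda>i. \<i> * v i)"

definition lin2 :: "real \<Rightarrow> cvec \<Rightarrow> real \<Rightarrow> cvec \<Rightarrow> cvec" where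
  "lin2 a v b w = (\<lambda>i. of_real a * v i + of_real b * w i)"

definition dir_deriv :: "cvec \<Rightarrow> (cvec \<Rightarrow> 'b::real_normed_vector) \<Rightarrow> cvec \<Rightarrow> 'b" where
  "dir_deriv v f z = vector_derivative (\<lambda>t::real. f (lin2 1 z t v)) (at 0)"

primrec Ck_on :: "nat \<Rightarrow> nat \<Rightarrow> cvec set \<Rightarrow> (cvec \<Rightarrow> 'b::real_normed_vector) \<Rightarrow> bool" where
  "Ck_on 0 m S f \<longleftrightarrow> continuous_on S f"
| "Ck_on (Suc k) m S f \<longleftrightarrow> continuous_on S f \<and>
     (\<forall>v\<in>Csp m. (\<forall>z\<in>S. (\<lambda>t::real. f (lin2 1 z t v)) differentiable (at 0)) \<and>
                 Ck_on k m S (dir_deriv v f))"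

definition smooth_on :: "nat \<Rightarrow> cvec set \<Rightarrow> (cvec \<Rightarrow> 'b::real_normed_vector) \<Rightarrow> bool" where
  "smooth_on m S f \<longleftrightarrow> (\<forall>k. Ck_on k m S f)"

definition differential :: "(cvec \<Rightarrow> cvec) \<Rightarrow> cvec \<Rightarrow> cvec \<Rightarrow> cvec" where
  "differential F z v = (\<lambda>i. dir_deriv v (\<lambda>u. F u i) z)"

text \<open>The second conjunct is the Cauchy-Riemann system: the differential is complex linear.\<close>

definition holo_on :: "nat \<Rightarrow> cvec set \<Rightarrow> (cvec \<Rightarrow> cvec) \<Rightarrow> bool" where
  "holo_on m S F \<longleftrightarrow> (\<forall>i. smooth_on m S (\<lambda>z. F z i)) \<and>
     (\<forall>z\<in>S. \<forall>v\<in>Csp m. differential F z (Jop v) = Jop (differential F z v))"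


section \<open>Complex manifolds and holomorphic maps\<close>

text \<open>
  A chart is a pair of its domain and its coordinate map (irrelevant outside the domain).  Atlases
  are not required to be maximal: the notions below do not depend on the atlas chosen within its
  equivalence class, forms being extended to further compatible charts by change of coordinates.
  The points of a manifold form a set within a type; since a connected second countable manifold
  embeds in some \<open>Csp N\<close>, taking \<^typ>\<open>cvec\<close> for this type is no restriction.
\<close>

type_synonym 'a chart = "'a set \<times> ('a \<Rightarrow> cvec)"

record 'a cmfd =
  mtop :: "'a topology"
  mdim :: nat
  atlas :: "'a chart set"

definition chart_image :: "'a chart \<Rightarrow> cvec set" where
  "chart_image C = snd C ` fst C"

definition chart_inv :: "'a chart \<Rightarrow> cvec \<Rightarrow> 'a" where
  "chart_inv C = inv_into (fst C) (snd C)"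

text \<open>The expression of \<open>f\<close> in the charts \<open>C\<close> and \<open>D\<close>, and its domain.\<close>

definition in_charts :: "'a chart \<Rightarrow> 'b chart \<Rightarrow> ('a \<Rightarrow> 'b) \<Rightarrow> cvec \<Rightarrow> cvec" where
  "in_charts C D f z = snd D (f (chart_inv C z))"

definition in_charts_dom :: "'a chart \<Rightarrow> 'b chart \<Rightarrow> ('a \<Rightarrow> 'b) \<Rightarrow> cvec set" where
  "in_charts_dom C D f = snd C ` {x \<in> fst C. f x \<in> fst D}"

definition complex_manifold :: "'a cmfd \<Rightarrow> bool" where
  "complex_manifold M \<longleftrightarrow>
     Hausdorff_space (mtop M) \<and> second_countable (mtop M) \<and> connected_space (mtop M) \<and>
     topspace (mtop M) = (\<Union>C\<in>atlas M. fst C) \<and>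
     (\<forall>C\<in>atlas M. openin (mtop M) (fst C) \<and>
        openin (top_of_set (Csp (mdim M))) (chart_image C) \<and>
        homeomorphic_map (subtopology (mtop M) (fst C)) (top_of_set (chart_image C)) (snd C)) \<and>
     (\<forall>C\<in>atlas M. \<forall>D\<in>atlas M.
        holo_on (mdim M) (in_charts_dom C D (\<lambda>x. x)) (in_charts C D (\<lambda>x. x)))"

definition holomorphic_map :: "'a cmfd \<Rightarrow> 'b cmfd \<Rightarrow> ('a \<Rightarrow> 'b) \<Rightarrow> bool" where
  "holomorphic_map M N f \<longleftrightarrow> continuous_map (mtop M) (mtop N) f \<and>
     (\<forall>C\<in>atlas M. \<forall>D\<in>atlas N. holo_on (mdim M) (in_charts_dom C D f) (in_charts C D f))"

definition submersion :: "'a cmfd \<Rightarrow> 'b cmfd \<Rightarrow> ('a \<Rightarrow> 'b) \<Rightarrow> bool" where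
  "submersion M N f \<longleftrightarrow> (\<forall>C\<in>atlas M. \<forall>D\<in>atlas N. \<forall>z\<in>in_charts_dom C D f.
     differential (in_charts C D f) z ` Csp (mdim M) = Csp (mdim N))"

definition immersion :: "'a cmfd \<Rightarrow> 'b cmfd \<Rightarrow> ('a \<Rightarrow> 'b) \<Rightarrow> bool" where
  "immersion M N f \<longleftrightarrow> (\<forall>C\<in>atlas M. \<forall>D\<in>atlas N. \<forall>z\<in>in_charts_dom C D f.
     inj_on (differential (in_charts C D f) z) (Csp (mdim M)))"

text \<open>
  \<open>S\<close> is an embedded complex submanifold of \<open>M\<close>.  Its complex structure is determined, up to
  compatible change of the atlas, by \<open>M\<close> and the set of points of \<open>S\<close>.
\<close>

definition complex_submanifold :: "'a cmfd \<Rightarrow> 'a cmfd \<Rightarrow> bool" where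
  "complex_submanifold S M \<longleftrightarrow> complex_manifold S \<and>
     topspace (mtop S) \<subseteq> topspace (mtop M) \<and>
     mtop S = subtopology (mtop M) (topspace (mtop S)) \<and>
     holomorphic_map S M (\<lambda>x. x) \<and> immersion S M (\<lambda>x. x)"

text \<open>
  A smooth proper fibration \<open>p\<close>, together with its fibres \<open>F y\<close> as complex submanifolds of the total
  space; fibres are connected because complex manifolds are.
\<close>

definition smooth_proper_fibration ::
    "'a cmfd \<Rightarrow> 'b cmfd \<Rightarrow> ('a \<Rightarrow> 'b) \<Rightarrow> ('b \<Rightarrow> 'a cmfd) \<Rightarrow> bool" where
  "smooth_proper_fibration X Y p F \<longleftrightarrow>
     complex_manifold X \<and> complex_manifold Y \<and>
     holomorphic_map X Y p \<and> p ` topspace (mtop X) = topspace (mtop Y) \<and>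
     submersion X Y p \<and> proper_map (mtop X) (mtop Y) p \<and>
     (\<forall>y\<in>topspace (mtop Y). complex_submanifold (F y) X \<and>
        mdim (F y) = mdim X - mdim Y \<and>
        topspace (mtop (F y)) = {x \<in> topspace (mtop X). p x = y})"


section \<open>Differential forms\<close>

text \<open>
  A real \<open>k\<close>-form is given by its expressions in the charts: \<open>\<alpha> C z vs\<close> is the value, at the point
  with coordinates \<open>z\<close> in the chart \<open>C\<close>, on the list \<open>vs\<close> of \<open>k\<close> tangent vectors in coordinates.
  Only \<open>C\<close> in the atlas, \<open>z\<close> in the image of \<open>C\<close> and vectors in \<open>Csp (mdim M)\<close> are significant.
\<close>

type_synonym 'a form = "'a chart \<Rightarrow> cvec \<Rightarrow> cvec list \<Rightarrow> real"

definition tangent_lists :: "'a cmfd \<Rightarrow> nat \<Rightarrow> cvec list set" where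
  "tangent_lists M k = {vs. length vs = k \<and> set vs \<subseteq> Csp (mdim M)}"

definition smooth_form :: "'a cmfd \<Rightarrow> nat \<Rightarrow> 'a form \<Rightarrow> bool" where
  "smooth_form M k \<alpha> \<longleftrightarrow>
     (\<forall>C\<in>atlas M. \<forall>vs\<in>tangent_lists M k.
        smooth_on (mdim M) (chart_image C) (\<lambda>z. \<alpha> C z vs) \<and>
        (\<forall>z\<in>chart_image C.
           (\<forall>i<k. \<forall>v\<in>Csp (mdim M). \<forall>w\<in>Csp (mdim M). \<forall>a b.
              \<alpha> C z (vs[i := lin2 a v b w]) = a * \<alpha> C z (vs[i := v]) + b * \<alpha> C z (vs[i := w])) \<and>
           (\<forall>i<k. \<forall>j<k. i \<noteq> j \<and> vs ! i = vs ! j \<longrightarrow> \<alpha> C z vs = 0))) \<and>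
     (\<forall>C\<in>atlas M. \<forall>D\<in>atlas M. \<forall>z\<in>in_charts_dom C D (\<lambda>x. x). \<forall>vs\<in>tangent_lists M k.
        \<alpha> C z vs = \<alpha> D (in_charts C D (\<lambda>x. x) z)
                     (map (differential (in_charts C D (\<lambda>x. x)) z) vs))"

definition form_eq :: "'a cmfd \<Rightarrow> nat \<Rightarrow> 'a form \<Rightarrow> 'a form \<Rightarrow> bool" where
  "form_eq M k \<alpha> \<beta> \<longleftrightarrow>
     (\<forall>C\<in>atlas M. \<forall>z\<in>chart_image C. \<forall>vs\<in>tangent_lists M k. \<alpha> C z vs = \<beta> C z vs)"

definition zero_form :: "'a form" where
  "zero_form C z vs = 0"

definition add_form :: "'a form \<Rightarrow> 'a form \<Rightarrow> 'a form" where
  "add_form \<alpha> \<beta> C z vs = \<alpha> C z vs + \<beta> C z vs"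

definition scale_form :: "real \<Rightarrow> 'a form \<Rightarrow> 'a form" where
  "scale_form r \<alpha> C z vs = r * \<alpha> C z vs"

definition fun_form :: "('a \<Rightarrow> real) \<Rightarrow> 'a form" where
  "fun_form f C z vs = f (chart_inv C z)"

definition mult_form :: "('a \<Rightarrow> real) \<Rightarrow> 'a form \<Rightarrow> 'a form" where
  "mult_form f \<alpha> C z vs = f (chart_inv C z) * \<alpha> C z vs"

definition smooth_fun :: "'a cmfd \<Rightarrow> ('a \<Rightarrow> real) \<Rightarrow> bool" where
  "smooth_fun M f \<longleftrightarrow>
     (\<forall>C\<in>atlas M. smooth_on (mdim M) (chart_image C) (\<lambda>z. f (chart_inv C z)))"

text \<open>
  The usual formula for the exterior derivative on coordinate (hence commuting) vector fields, the
  degree being read off from the number of vectors.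
\<close>

definition ext_d :: "'a form \<Rightarrow> 'a form" where
  "ext_d \<alpha> C z vs = (\<Sum>i<length vs. (-1) ^ i *
     dir_deriv (vs ! i) (\<lambda>u. \<alpha> C u (take i vs @ drop (Suc i) vs)) z)"

text \<open>
  On \<open>0\<close>-forms \<open>d\<^sup>c f = - df \<circ> J = i (\<partial>' - \<partial>) f\<close>, where \<open>\<partial>'\<close> is the anti-holomorphic part
  of \<open>d\<close>, so that \<open>dd\<^sup>c = 2 i \<partial> \<partial>'\<close>.  Another normalisation rescales the potentials by a positive
  constant and does not change the relative Ricci-flat metric.
\<close>

definition dc :: "'a form \<Rightarrow> 'a form" where
  "dc f C z vs = - ext_d f C z (map Jop vs)"

definition ddc :: "'a form \<Rightarrow> 'a form" where
  "ddc f = ext_d (dc f)"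

text \<open>The chart of the target is immaterial, by the compatibility condition in \<^const>\<open>smooth_form\<close>.\<close>

definition pullback :: "'b cmfd \<Rightarrow> ('a \<Rightarrow> 'b) \<Rightarrow> 'b form \<Rightarrow> 'a form" where
  "pullback N f \<alpha> C z vs =
     (let D = (SOME D. D \<in> atlas N \<and> f (chart_inv C z) \<in> fst D)
      in \<alpha> D (in_charts C D f z) (map (differential (in_charts C D f) z) vs))"

text \<open>Restriction to a submanifold of \<open>M\<close>, that is, pullback along the inclusion.\<close>

definition restrict_form :: "'a cmfd \<Rightarrow> 'a form \<Rightarrow> 'a form" where
  "restrict_form M = pullback M (\<lambda>x. x)"

text \<open>The \<open>n\<close>-fold exterior power \<open>\<omega> \<and> \<dots> \<and> \<omega>\<close> of a \<open>2\<close>-form, evaluated on \<open>2 n\<close> vectors.\<close>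

definition wedge_power :: "nat \<Rightarrow> 'a form \<Rightarrow> 'a form" where
  "wedge_power n \<omega> C z vs =
     (\<Sum>\<sigma> | \<sigma> permutes {..<2 * n}. of_int (sign \<sigma>) *
        (\<Prod>i<n. \<omega> C z [vs ! \<sigma> (2 * i), vs ! \<sigma> (2 * i + 1)])) / 2 ^ n"

text \<open>The real frame \<open>\<partial>/\<partial>x\<^sub>1, \<partial>/\<partial>y\<^sub>1, \<dots>, \<partial>/\<partial>x\<^sub>m, \<partial>/\<partial>y\<^sub>m\<close>, positively oriented.\<close>

definition std_frame :: "nat \<Rightarrow> cvec list" where
  "std_frame m = concat (map (\<lambda>j. [cunit j, Jop (cunit j)]) [0..<m])"

definition lebesgue_Csp :: "nat \<Rightarrow> (cvec \<Rightarrow> real) \<Rightarrow> real" where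
  "lebesgue_Csp m f =
     (LINT x|(\<Pi>\<^sub>M i\<in>{..<m}. (lborel :: complex measure)). f (\<lambda>i. if i < m then x i else 0))"

text \<open>
  The integral of a form of top degree over a compact complex manifold, by means of a continuous
  partition of unity subordinate to finitely many charts; it does not depend on the partition.
\<close>

definition form_has_integral :: "'a cmfd \<Rightarrow> 'a form \<Rightarrow> real \<Rightarrow> bool" where
  "form_has_integral M \<eta> I \<longleftrightarrow> compact_space (mtop M) \<and>
     (\<exists>K \<rho>. finite K \<and> K \<subseteq> atlas M \<and>
        (\<forall>C\<in>K. continuous_map (mtop M) euclideanreal (\<rho> C) \<and>
               (\<forall>x\<in>topspace (mtop M). 0 \<le> \<rho> C x) \<and>
               mtop M closure_of {x \<in> topspace (mtop M). \<rho> C x \<noteq> 0} \<subseteq> fst C) \<and>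
        (\<forall>x\<in>topspace (mtop M). (\<Sum>C\<in>K. \<rho> C x) = 1) \<and>
        I = (\<Sum>C\<in>K. lebesgue_Csp (mdim M)
               (\<lambda>z. if z \<in> chart_image C
                     then \<rho> C (chart_inv C z) * \<eta> C z (std_frame (mdim M)) else 0)))"


section \<open>Kaehler geometry\<close>

definition type_1_1 :: "'a cmfd \<Rightarrow> 'a form \<Rightarrow> bool" where
  "type_1_1 M \<omega> \<longleftrightarrow> (\<forall>C\<in>atlas M. \<forall>z\<in>chart_image C. \<forall>v\<in>Csp (mdim M). \<forall>w\<in>Csp (mdim M).
     \<omega> C z [Jop v, Jop w] = \<omega> C z [v, w])"

definition positive_form :: "'a cmfd \<Rightarrow> 'a form \<Rightarrow> bool" where
  "positive_form M \<omega> \<longleftrightarrow> (\<forall>C\<in>atlas M. \<forall>z\<in>chart_image C. \<forall>v\<in>Csp (mdim M).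
     v \<noteq> (\<lambda>_. 0) \<longrightarrow> \<omega> C z [v, Jop v] > 0)"

definition semipositive_form :: "'a cmfd \<Rightarrow> 'a form \<Rightarrow> bool" where
  "semipositive_form M \<omega> \<longleftrightarrow> (\<forall>C\<in>atlas M. \<forall>z\<in>chart_image C. \<forall>v\<in>Csp (mdim M).
     \<omega> C z [v, Jop v] \<ge> 0)"

definition hermitian_form :: "'a cmfd \<Rightarrow> 'a form \<Rightarrow> bool" where
  "hermitian_form M \<omega> \<longleftrightarrow> smooth_form M 2 \<omega> \<and> type_1_1 M \<omega> \<and> positive_form M \<omega>"

definition kahler_form :: "'a cmfd \<Rightarrow> 'a form \<Rightarrow> bool" where
  "kahler_form M \<omega> \<longleftrightarrow> hermitian_form M \<omega> \<and> form_eq M 3 (ext_d \<omega>) zero_form"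

definition kahler_manifold :: "'a cmfd \<Rightarrow> bool" where
  "kahler_manifold M \<longleftrightarrow> complex_manifold M \<and> (\<exists>\<omega>. kahler_form M \<omega>)"

text \<open>
  \<open>Ric \<omega> = - i \<partial> \<partial>' log det g = - (1/2) dd\<^sup>c log det g\<close> in each chart, where \<open>det g\<close> is up to
  a constant factor the coefficient of \<open>\<omega>\<^sup>m\<close>, \<open>m\<close> the dimension.  For a Hermitian \<open>\<omega>\<close> this
  is the curvature form of the metric that \<open>\<omega>\<close> induces on the anticanonical bundle.
\<close>

definition log_density :: "'a cmfd \<Rightarrow> 'a form \<Rightarrow> 'a form" where
  "log_density M \<omega> C z vs = ln (wedge_power (mdim M) \<omega> C z (std_frame (mdim M)))"

definition ricci_form :: "'a cmfd \<Rightarrow> 'a form \<Rightarrow> 'a form" where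
  "ricci_form M \<omega> = scale_form (- 1 / 2) (ddc (log_density M \<omega>))"

definition chern_form :: "'a cmfd \<Rightarrow> 'a form \<Rightarrow> 'a form" where
  "chern_form M \<omega> = scale_form (1 / (2 * pi)) (ricci_form M \<omega>)"

definition exact_form :: "'a cmfd \<Rightarrow> nat \<Rightarrow> 'a form \<Rightarrow> bool" where
  "exact_form M k \<alpha> \<longleftrightarrow> (\<exists>\<beta>. smooth_form M (k - 1) \<beta> \<and> form_eq M k \<alpha> (ext_d \<beta>))"

text \<open>
  The first Chern class of \<open>M\<close> in real de Rham cohomology is the class of the Chern form of the
  anticanonical bundle for any Hermitian metric (Chern-Weil); the class does not depend on the
  metric.
\<close>

definition c1_zero :: "'a cmfd \<Rightarrow> bool" where
  "c1_zero M \<longleftrightarrow> (\<exists>g. hermitian_form M g \<and> exact_form M 2 (chern_form M g))"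

text \<open>
  \<open>\<phi>\<close> is the smooth function on \<open>X\<close> restricting on every fibre \<open>F y\<close> to the normalised potential of
  the Ricci-flat Kaehler form in the class of \<open>\<omega>\<close>; by Yau's theorem it is unique.
\<close>

definition ricci_flat_potential ::
    "'a cmfd \<Rightarrow> 'b cmfd \<Rightarrow> ('b \<Rightarrow> 'a cmfd) \<Rightarrow> 'a form \<Rightarrow> ('a \<Rightarrow> real) \<Rightarrow> bool" where
  "ricci_flat_potential X Y F \<omega> \<phi> \<longleftrightarrow> smooth_fun X \<phi> \<and>
     (\<forall>y\<in>topspace (mtop Y).
        let \<omega>y = restrict_form X \<omega>; \<theta>y = add_form \<omega>y (ddc (fun_form \<phi>))
        in smooth_fun (F y) \<phi> \<and>
           kahler_form (F y) \<theta>y \<and>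
           form_eq (F y) 2 (ricci_form (F y) \<theta>y) zero_form \<and>
           form_has_integral (F y) (mult_form \<phi> (wedge_power (mdim (F y)) \<omega>y)) 0)"

definition relative_ricci_flat_metric ::
    "'a cmfd \<Rightarrow> 'b cmfd \<Rightarrow> ('b \<Rightarrow> 'a cmfd) \<Rightarrow> 'a form \<Rightarrow> 'a form \<Rightarrow> bool" where
  "relative_ricci_flat_metric X Y F \<omega> \<theta> \<longleftrightarrow>
     (\<exists>\<phi>. ricci_flat_potential X Y F \<omega> \<phi> \<and> \<theta> = add_form \<omega> (ddc (fun_form \<phi>)))"

end

theory Submission
  imports Defs
begin

text \<open>
  The fibration can be a product: a torus \<open>E\<close> times the unit disc, with coordinates \<open>z\<close> on
  \<open>E = \<complex> / 2 \<pi> (\<int> + i \<int>)\<close> and \<open>t\<close> on the disc.  Write \<open>R = Re (t exp(i x))\<close> with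
  \<open>x = Re z\<close>, and let \<open>a\<^sub>z\<close>, \<open>a\<^sub>t\<close> be the area forms of the two factors.  Take
  \<open>\<omega> = 6 a\<^sub>z + a\<^sub>t + dd\<^sup>c (2 R)\<close>.  Its Hermitian matrix has diagonal entries \<open>6 - 2 R\<close> and \<open>1\<close>
  and off-diagonal entries of modulus \<open>2\<close>, so \<open>\<omega>\<close> is positive because \<open>R < 1\<close> (lemma
  \<open>omega_self\<close> completes the square).
  
  On every fibre the flat metric in the class of \<open>\<omega>\<close> is \<open>6 a\<^sub>z\<close>, hence the potential has the form
  \<open>\<phi> = g(t) - 2 R\<close>.  The fibrewise mean of \<open>R\<^sup>2\<close> is \<open>|t|\<^sup>2 / 2\<close>, so the normalisation, that
  \<open>(g - 2 R) (6 - 2 R)\<close> has mean zero, forces \<open>g = - |t|\<^sup>2 / 3\<close> (lemma \<open>integral_potential_zero\<close>).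
  Therefore \<open>\<omega> + dd\<^sup>c \<phi> = 6 a\<^sub>z + a\<^sub>t + dd\<^sup>c g = 6 a\<^sub>z - (1/3) a\<^sub>t\<close> (lemma \<open>ddc_phi_lift\<close>),
  which is negative in the direction of the disc.
  
  The reason that leaves room for such an example is the normalisation by \<open>\<omega>\<close>.  The Dirichlet energy
  of the fibrewise potential enters \<open>g\<close> with full weight, while the positivity of the
  push-forward of \<open>\<omega> \<and> \<omega>\<close> to the base controls only half of it.
  
  To do calculus on the product, both it and its fibres are described by coverings
  \<open>(x + i y, t) \<mapsto> (exp(i x), exp(i y), c + t)\<close>.  All charts are local inverses of these, all maps in
  question lift to affine maps, and all forms lift to forms whose coefficients are trigonometric
  polynomials.
\<close>

section \<open>Calculus along lines\<close>

lemma lin2_apply [simp]: "lin2 a v b w i = of_real a * v i + of_real b * w i"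
  by (simp add: lin2_def)

lemma lin2_1_0 [simp]: "lin2 1 z 0 v = z"
  by (auto simp: lin2_def)

lemma Jop_apply [simp]: "Jop v i = \<i> * v i"
  by (simp add: Jop_def)

lemma Csp_lin2: "v \<in> Csp m \<Longrightarrow> w \<in> Csp m \<Longrightarrow> lin2 a v b w \<in> Csp m"
  by (auto simp: Csp_def)

lemma Csp_Jop: "v \<in> Csp m \<Longrightarrow> Jop v \<in> Csp m"
  by (auto simp: Csp_def)

lemma continuous_on_lin2:
  assumes "continuous_on A a" "continuous_on A f" "continuous_on A b" "continuous_on A g"
  shows "continuous_on A (\<lambda>x. lin2 (a x) (f x) (b x) (g x))"
  unfolding lin2_def
  by (rule continuous_on_coordinatewise_then_product)
    (intro continuous_on_add continuous_on_mult continuous_on_of_real assms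
      continuous_on_product_then_coordinatewise[OF assms(2)]
      continuous_on_product_then_coordinatewise[OF assms(4)])

lemma eventually_line_in:
  assumes "openin (top_of_set (Csp m)) U" "z \<in> U" "v \<in> Csp m"
  shows "eventually (\<lambda>t::real. lin2 1 z t v \<in> U) (nhds 0)"
proof -
  have zC: "z \<in> Csp m" using assms by (meson openin_imp_subset subsetD)
  have "continuous_on UNIV (\<lambda>t::real. lin2 1 z t v)"
    by (intro continuous_on_lin2 continuous_intros)
  then have "openin (top_of_set UNIV) (UNIV \<inter> (\<lambda>t::real. lin2 1 z t v) -` U)"
    by (rule continuous_openin_preimage) (use Csp_lin2 zC assms in auto)
  then have "open ((\<lambda>t::real. lin2 1 z t v) -` U)" by simp
  then show ?thesis
    unfolding eventually_nhds using assms(2)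
    by (intro exI[of _ "(\<lambda>t::real. lin2 1 z t v) -` U"]) simp
qed

lemma dir_deriv_local:
  assumes "openin (top_of_set (Csp m)) U" "z \<in> U" "v \<in> Csp m" "\<And>w. w \<in> U \<Longrightarrow> f w = g w"
  shows "dir_deriv v f z = dir_deriv v g z"
  unfolding dir_deriv_def
proof (rule vector_derivative_cong_eq)
  show "\<forall>\<^sub>F t in nhds 0. t \<in> UNIV \<longrightarrow> f (lin2 1 z t v) = g (lin2 1 z t v)"
    using eventually_line_in[OF assms(1-3)] by eventually_elim (simp add: assms(4))
qed simp_all

lemma differentiable_line_local:
  fixes f g :: "cvec \<Rightarrow> 'b::real_normed_vector"
  assumes U: "openin (top_of_set (Csp m)) U" "z \<in> U" "v \<in> Csp m" and eq: "\<And>w. w \<in> U \<Longrightarrow> f w = g w"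
    and g: "(\<lambda>t::real. g (lin2 1 z t v)) differentiable (at 0)"
  shows "(\<lambda>t::real. f (lin2 1 z t v)) differentiable (at 0)"
proof -
  obtain D where "((\<lambda>t::real. g (lin2 1 z t v)) has_derivative D) (at 0)"
    using g by (auto simp: differentiable_def)
  moreover have ev: "eventually (\<lambda>t::real. g (lin2 1 z t v) = f (lin2 1 z t v)) (at 0)"
    using eventually_line_in[OF U] unfolding eventually_at_filter
    by eventually_elim (simp add: eq)
  ultimately have "((\<lambda>t::real. f (lin2 1 z t v)) has_derivative D) (at 0)"
    by (rule has_derivative_transform_eventually) (simp_all add: eq U(2))
  then show ?thesis by (auto simp: differentiable_def)
qed

lemma dir_derivI:
  "((\<lambda>t::real. f (lin2 1 z t v)) has_vector_derivative D) (at 0) \<Longrightarrow> dir_deriv v f z = D"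
  unfolding dir_deriv_def by (rule vector_derivative_at)

lemma dir_derivI_real:
  "((\<lambda>t::real. f (lin2 1 z t v)) has_real_derivative D) (at 0) \<Longrightarrow> dir_deriv v f z = D"
  by (rule dir_derivI) (simp add: has_real_derivative_iff_has_vector_derivative)

lemma dir_deriv_const [simp]: "dir_deriv v (\<lambda>_. c) z = 0"
  by (rule dir_derivI) simp

definition derivation_closed :: "(cvec \<Rightarrow> 'b::real_normed_vector) set \<Rightarrow> bool" where
  "derivation_closed \<F> \<longleftrightarrow> (\<forall>g\<in>\<F>. continuous_on UNIV g \<and>
     (\<forall>v. (\<forall>z. (\<lambda>t::real. g (lin2 1 z t v)) differentiable (at 0)) \<and> dir_deriv v g \<in> \<F>))"

text \<open>
  Smoothness asks for iterated derivatives of every order, so it is convenient to have a stock of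
  functions that is stable under differentiation: membership then settles all orders at once.  Only
  germs matter, which allows the stock to differ from the given function away from each point.
\<close>

lemma smooth_on_locally:
  assumes \<F>: "derivation_closed \<F>" and S: "openin (top_of_set (Csp m)) S"
    and loc: "\<And>z. z \<in> S \<Longrightarrow> \<exists>g\<in>\<F>. \<exists>U. openin (top_of_set (Csp m)) U \<and> z \<in> U \<and> (\<forall>w\<in>U. f w = g w)"
  shows "smooth_on m S f"
  unfolding smooth_on_def
proof
  fix k show "Ck_on k m S f" using loc
  proof (induction k arbitrary: f)
    case (0 f)
    show ?case unfolding Ck_on.simps continuous_on_eq_continuous_within
    proof
      fix z assume z: "z \<in> S"
      obtain g U where g: "g \<in> \<F>" and U: "openin (top_of_set (Csp m)) U" "z \<in> U" "\<forall>w\<in>U. f w = g w"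
        using 0[OF z] by blast
      have "continuous (at z within Csp m) g"
        using g \<F> by (meson derivation_closed_def continuous_on_eq_continuous_at open_UNIV UNIV_I
            continuous_at_imp_continuous_within)
      then have "continuous (at z within Csp m) f"
        by (rule continuous_transform_within_openin[OF _ U(1,2)]) (use U(3) in auto)
      then show "continuous (at z within S) f"
        using S by (meson continuous_within_subset openin_imp_subset)
    qed
  next
    case (Suc k f)
    have "continuous_on S f"
    proof -
      have "Ck_on k m S f" using Suc by blast
      then show ?thesis by (cases k) auto
    qed
    moreover have "(\<lambda>t::real. f (lin2 1 z t v)) differentiable (at 0)" if v: "v \<in> Csp m" and z: "z \<in> S" for v z
    proof -
      obtain g U where g: "g \<in> \<F>" and U: "openin (top_of_set (Csp m)) U" "z \<in> U" "\<forall>w\<in>U. f w = g w"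
        using Suc.prems[OF z] by blast
      show ?thesis
        by (rule differentiable_line_local[OF U(1,2) v]) (use U(3) g \<F> in \<open>auto simp: derivation_closed_def\<close>)
    qed
    moreover have "Ck_on k m S (dir_deriv v f)" if v: "v \<in> Csp m" for v
    proof (rule Suc.IH)
      fix z assume z: "z \<in> S"
      obtain g U where g: "g \<in> \<F>" and U: "openin (top_of_set (Csp m)) U" "z \<in> U" "\<forall>w\<in>U. f w = g w"
        using Suc.prems[OF z] by blast
      have "\<forall>w\<in>U. dir_deriv v f w = dir_deriv v g w"
        using dir_deriv_local[OF U(1) _ v] U(3) by blast
      moreover have "dir_deriv v g \<in> \<F>" using g \<F> by (auto simp: derivation_closed_def)
      ultimately show "\<exists>g\<in>\<F>. \<exists>U. openin (top_of_set (Csp m)) U \<and> z \<in> U \<and> (\<forall>w\<in>U. dir_deriv v f w = g w)"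
        using U by blast
    qed
    ultimately show ?case by simp
  qed
qed

text \<open>
  The coefficients of all forms below, in lifted coordinates.  Only real parts occur inside the
  trigonometric functions because the potential depends on \<open>z\<close> through \<open>Re z\<close>.
\<close>

inductive_set trig_poly :: "(cvec \<Rightarrow> real) set" where
  const: "(\<lambda>_. c) \<in> trig_poly"
| Re: "(\<lambda>z. Re (z i)) \<in> trig_poly"
| Im: "(\<lambda>z. Im (z i)) \<in> trig_poly"
| cos: "(\<lambda>z. cos (Re (z i))) \<in> trig_poly"
| sin: "(\<lambda>z. sin (Re (z i))) \<in> trig_poly"
| add: "f \<in> trig_poly \<Longrightarrow> g \<in> trig_poly \<Longrightarrow> (\<lambda>z. f z + g z) \<in> trig_poly"
| mult: "f \<in> trig_poly \<Longrightarrow> g \<in> trig_poly \<Longrightarrow> (\<lambda>z. f z * g z) \<in> trig_poly"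

lemma trig_poly_minus: "f \<in> trig_poly \<Longrightarrow> (\<lambda>z. - f z) \<in> trig_poly"
  using trig_poly.mult[OF trig_poly.const[of "-1"]] by simp

lemma trig_poly_diff: "f \<in> trig_poly \<Longrightarrow> g \<in> trig_poly \<Longrightarrow> (\<lambda>z. f z - g z) \<in> trig_poly"
  using trig_poly.add[OF _ trig_poly_minus] by simp

lemma trig_poly_derivation:
  assumes "f \<in> trig_poly"
  shows "continuous_on UNIV f \<and>
    (\<forall>v. \<exists>D\<in>trig_poly. \<forall>z. ((\<lambda>t::real. f (lin2 1 z t v)) has_real_derivative D z) (at 0))"
  using assms
proof induction
  case (const c)
  show ?case by (auto intro!: bexI[of _ "\<lambda>_. 0"] trig_poly.intros continuous_intros)
next
  case (Re i)
  have "((\<lambda>t::real. Re (lin2 1 z t v i)) has_real_derivative Re (v i)) (at 0)" for z v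
    by (auto intro!: derivative_eq_intros)
  then show ?case
    by (auto intro!: bexI[of _ "\<lambda>_. Re (v i)" for v] trig_poly.intros continuous_intros)
next
  case (Im i)
  have "((\<lambda>t::real. Im (lin2 1 z t v i)) has_real_derivative Im (v i)) (at 0)" for z v
    by (auto intro!: derivative_eq_intros)
  then show ?case
    by (auto intro!: bexI[of _ "\<lambda>_. Im (v i)" for v] trig_poly.intros continuous_intros)
next
  case (cos i)
  have "((\<lambda>t::real. cos (Re (lin2 1 z t v i))) has_real_derivative (- Re (v i)) * sin (Re (z i))) (at 0)" for z v
    by (auto intro!: derivative_eq_intros)
  moreover have "(\<lambda>z. (- Re (v i)) * sin (Re (z i))) \<in> trig_poly" for v
    by (intro trig_poly.intros)
  ultimately show ?case
    by (fastforce intro!: continuous_intros)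
next
  case (sin i)
  have "((\<lambda>t::real. sin (Re (lin2 1 z t v i))) has_real_derivative (Re (v i)) * cos (Re (z i))) (at 0)" for z v
    by (auto intro!: derivative_eq_intros)
  moreover have "(\<lambda>z. (Re (v i)) * cos (Re (z i))) \<in> trig_poly" for v
    by (intro trig_poly.intros)
  ultimately show ?case
    by (fastforce intro!: continuous_intros)
next
  case (add f g)
  have "\<exists>D\<in>trig_poly. \<forall>z. ((\<lambda>t::real. f (lin2 1 z t v) + g (lin2 1 z t v)) has_real_derivative D z) (at 0)" for v
  proof -
    obtain D D' where "D \<in> trig_poly" "\<forall>z. ((\<lambda>t::real. f (lin2 1 z t v)) has_real_derivative D z) (at 0)"
      "D' \<in> trig_poly" "\<forall>z. ((\<lambda>t::real. g (lin2 1 z t v)) has_real_derivative D' z) (at 0)"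
      using add.IH by blast
    then show ?thesis
      by (intro bexI[of _ "\<lambda>z. D z + D' z"] allI DERIV_add trig_poly.add) auto
  qed
  then show ?case using add.IH by (blast intro: continuous_on_add)
next
  case (mult f g)
  have "\<exists>D\<in>trig_poly. \<forall>z. ((\<lambda>t::real. f (lin2 1 z t v) * g (lin2 1 z t v)) has_real_derivative D z) (at 0)" for v
  proof -
    obtain D D' where D: "D \<in> trig_poly" "\<And>z. ((\<lambda>t::real. f (lin2 1 z t v)) has_real_derivative D z) (at 0)"
      "D' \<in> trig_poly" "\<And>z. ((\<lambda>t::real. g (lin2 1 z t v)) has_real_derivative D' z) (at 0)"
      using mult.IH by blast
    have "((\<lambda>t::real. f (lin2 1 z t v) * g (lin2 1 z t v)) has_real_derivative D z * g z + D' z * f z) (at 0)" for z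
      using DERIV_mult[OF D(2)[of z] D(4)[of z]] by simp
    moreover have "(\<lambda>z. D z * g z + D' z * f z) \<in> trig_poly"
      using D mult.hyps by (intro trig_poly.intros) auto
    ultimately show ?thesis by (intro bexI[of _ "\<lambda>z. D z * g z + D' z * f z"] allI)
  qed
  then show ?case using mult.IH by (blast intro: continuous_on_mult)
qed

lemma derivation_closed_trig_poly: "derivation_closed trig_poly"
  unfolding derivation_closed_def
proof (intro ballI conjI allI)
  fix f :: "cvec \<Rightarrow> real" and v z assume f: "f \<in> trig_poly"
  show "continuous_on UNIV f" using trig_poly_derivation[OF f] by blast
  obtain D where D: "D \<in> trig_poly" "\<And>z. ((\<lambda>t::real. f (lin2 1 z t v)) has_real_derivative D z) (at 0)"
    using trig_poly_derivation[OF f] by blast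
  show "(\<lambda>t::real. f (lin2 1 z t v)) differentiable (at 0)"
    using D(2)[of z] by (auto simp: real_differentiable_def)
  have "dir_deriv v f = D" using dir_derivI_real[OF D(2)] by auto
  then show "dir_deriv v f \<in> trig_poly" using D by simp
qed

lemma smooth_on_trig_poly:
  assumes "openin (top_of_set (Csp m)) S" "g \<in> trig_poly" "\<And>z. z \<in> S \<Longrightarrow> f z = g z"
  shows "smooth_on m S f"
  by (rule smooth_on_locally[OF derivation_closed_trig_poly assms(1)]) (use assms in blast)

section \<open>Affine maps\<close>

text \<open>
  Continuity is demanded componentwise, as the space of sequences carries the product topology.
\<close>

locale complex_linear_map =
  fixes L :: "cvec \<Rightarrow> cvec"
  assumes lin: "L (lin2 a v b w) = lin2 a (L v) b (L w)"
    and Jop_comm: "L (Jop v) = Jop (L v)"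
    and cont: "continuous_on UNIV (\<lambda>v. L v i)"
begin

lemma dir_deriv_affine: "dir_deriv v (\<lambda>z. c + L z i) z = L v i"
proof (rule dir_derivI)
  have "(\<lambda>t::real. c + L (lin2 1 z t v) i) = (\<lambda>t. c + L z i + t *\<^sub>R L v i)"
    by (auto simp: lin scaleR_conv_of_real)
  moreover have "((\<lambda>t::real. c + L z i + t *\<^sub>R L v i) has_vector_derivative L v i) (at 0)"
    by (auto intro!: derivative_eq_intros)
  ultimately show "((\<lambda>t. c + L (lin2 1 z t v) i) has_vector_derivative L v i) (at 0)" by simp
qed

lemma derivation_closed_affine: "derivation_closed (range (\<lambda>c z. c + L z i) \<union> range (\<lambda>c _. c))"
  unfolding derivation_closed_def
proof (intro ballI conjI allI)
  fix g :: "cvec \<Rightarrow> complex" and v z assume g: "g \<in> range (\<lambda>c z. c + L z i) \<union> range (\<lambda>c _. c)"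
  show "continuous_on UNIV g" using g cont by (auto intro!: continuous_intros)
  show "(\<lambda>t::real. g (lin2 1 z t v)) differentiable (at 0)"
    using g by (auto simp: lin intro!: derivative_intros)
  show "dir_deriv v g \<in> range (\<lambda>c z. c + L z i) \<union> range (\<lambda>c _. c)"
  proof (cases "\<exists>c. g = (\<lambda>_. c)")
    case False
    then obtain c where "g = (\<lambda>z. c + L z i)" using g by auto
    then have "dir_deriv v g = (\<lambda>_. L v i)" using dir_deriv_affine by auto
    then show ?thesis by auto
  next
    case True
    then obtain c where "g = (\<lambda>_. c)" by auto
    then have "dir_deriv v g = (\<lambda>_. 0)" by auto
    then show ?thesis by auto
  qed
qed

lemma holo_on_locally_affine:
  assumes S: "openin (top_of_set (Csp m)) S"
    and loc: "\<And>z. z \<in> S \<Longrightarrow> \<exists>c U. openin (top_of_set (Csp m)) U \<and> z \<in> U \<and> (\<forall>w\<in>U. G w = lin2 1 c 1 (L w))"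
  shows "holo_on m S G" and "z \<in> S \<Longrightarrow> v \<in> Csp m \<Longrightarrow> differential G z v = L v"
proof -
  show diff: "differential G z v = L v" if z: "z \<in> S" and v: "v \<in> Csp m" for z v
  proof
    fix i
    obtain c U where U: "openin (top_of_set (Csp m)) U" "z \<in> U" "\<forall>w\<in>U. G w = lin2 1 c 1 (L w)"
      using loc[OF z] by blast
    have "dir_deriv v (\<lambda>w. G w i) z = dir_deriv v (\<lambda>w. c i + L w i) z"
      by (rule dir_deriv_local[OF U(1,2) v]) (use U(3) in auto)
    then show "differential G z v i = L v i" by (simp add: differential_def dir_deriv_affine)
  qed
  have "smooth_on m S (\<lambda>w. G w i)" for i
  proof (rule smooth_on_locally[OF derivation_closed_affine S])
    fix z assume z: "z \<in> S"
    obtain c U where U: "openin (top_of_set (Csp m)) U" "z \<in> U" "\<forall>w\<in>U. G w = lin2 1 c 1 (L w)"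
      using loc[OF z] by blast
    then show "\<exists>g\<in>range (\<lambda>c z. c + L z i) \<union> range (\<lambda>c _. c). \<exists>U. openin (top_of_set (Csp m)) U \<and> z \<in> U \<and> (\<forall>w\<in>U. G w i = g w)"
      by (intro bexI[of _ "\<lambda>z. c i + L z i"] exI[of _ U]) auto
  qed
  then show "holo_on m S G"
    unfolding holo_on_def using diff Csp_Jop Jop_comm by auto
qed

end

section \<open>Manifolds covered by an open set of coordinates\<close>

definition cover_chart :: "(cvec \<Rightarrow> cvec) \<Rightarrow> cvec set \<Rightarrow> cvec chart" where
  "cover_chart E U = (E ` U, inv_into U E)"

lemma chart_image_cover_chart: "inj_on E U \<Longrightarrow> chart_image (cover_chart E U) = U"
  by (force simp: chart_image_def cover_chart_def image_iff)

lemma chart_inv_cover_chart: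
  assumes "inj_on E U" "z \<in> U"
  shows "chart_inv (cover_chart E U) z = E z"
proof -
  have "inj_on (inv_into U E) (E ` U)" by (simp add: inj_on_inv_into)
  then have "inv_into (E ` U) (inv_into U E) (inv_into U E (E z)) = E z"
    using assms(2) by (intro inv_into_f_f) auto
  then show ?thesis using assms by (simp add: chart_inv_def cover_chart_def)
qed

text \<open>
  A manifold is presented as the image of a set \<open>\<Omega>\<close> of coordinates under a map \<open>E\<close> that is a
  homeomorphism onto an open set on each \<open>U \<in> \<U>\<close>; the charts are the inverses.  If a translation
  identifies one pair of points under \<open>E\<close>, it does so for every pair in \<open>\<Omega>\<close> (assumption \<open>period\<close>);
  this makes the changes of charts local translations.
\<close>

locale affine_cover =
  fixes m :: nat and \<Omega> :: "cvec set" and E :: "cvec \<Rightarrow> cvec" and \<U> :: "cvec set set"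
  assumes Om_Csp: "\<Omega> \<subseteq> Csp m"
    and Om_connected: "connected \<Omega>"
    and E_continuous: "continuous_on \<Omega> E"
    and U_open: "U \<in> \<U> \<Longrightarrow> openin (top_of_set (Csp m)) U"
    and Union_U: "\<Union>\<U> = \<Omega>"
    and U_inj: "U \<in> \<U> \<Longrightarrow> inj_on E U"
    and EU_open: "U \<in> \<U> \<Longrightarrow> openin (top_of_set (E ` \<Omega>)) (E ` U)"
    and inverse_continuous: "U \<in> \<U> \<Longrightarrow> continuous_on (E ` U) (inv_into U E)"
    and period: "\<lbrakk>z \<in> \<Omega>; lin2 1 z 1 d \<in> \<Omega>; E (lin2 1 z 1 d) = E z; w \<in> \<Omega>; lin2 1 w 1 d \<in> \<Omega>\<rbrakk>
      \<Longrightarrow> E (lin2 1 w 1 d) = E w"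
begin

definition mfd :: "cvec cmfd" where
  "mfd = \<lparr>mtop = top_of_set (E ` \<Omega>), mdim = m, atlas = cover_chart E ` \<U>\<rparr>"

lemma mfd_simps [simp]:
  "mtop mfd = top_of_set (E ` \<Omega>)" "mdim mfd = m" "atlas mfd = cover_chart E ` \<U>"
  by (auto simp: mfd_def)

lemma U_Om: "U \<in> \<U> \<Longrightarrow> U \<subseteq> \<Omega>"
  using Union_U by auto

lemma chart_image_U [simp]: "U \<in> \<U> \<Longrightarrow> chart_image (cover_chart E U) = U"
  by (simp add: chart_image_cover_chart U_inj)

lemma chart_inv_U [simp]: "U \<in> \<U> \<Longrightarrow> z \<in> U \<Longrightarrow> chart_inv (cover_chart E U) z = E z"
  by (simp add: chart_inv_cover_chart U_inj)

end

text \<open>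
  A map \<open>f\<close> of such manifolds with a global affine lift \<open>z \<mapsto> c + L z\<close>.  The identity, the projection
  of a product and the inclusions of its fibres are all of this kind, so that holomorphy, ranks and
  pullbacks are read off from \<open>L\<close>.
\<close>

locale affine_cover_map = src: affine_cover m \<Omega> E \<U> + tgt: affine_cover m' \<Omega>' E' \<U>' + complex_linear_map L
  for m \<Omega> E \<U> m' \<Omega>' E' \<U>' L +
  fixes f :: "cvec \<Rightarrow> cvec" and c :: cvec
  assumes c_Csp: "c \<in> Csp m'" and L_Csp: "v \<in> Csp m \<Longrightarrow> L v \<in> Csp m'"
    and lift_Om: "z \<in> \<Omega> \<Longrightarrow> lin2 1 c 1 (L z) \<in> \<Omega>'"
    and lift: "z \<in> \<Omega> \<Longrightarrow> f (E z) = E' (lin2 1 c 1 (L z))"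
begin

abbreviation lft :: "cvec \<Rightarrow> cvec" where
  "lft z \<equiv> lin2 1 c 1 (L z)"

lemma lft_continuous: "continuous_on UNIV lft"
  by (intro continuous_on_lin2 continuous_intros continuous_on_coordinatewise_then_product cont)

lemma in_charts_dom_iff:
  assumes "U \<in> \<U>" "V \<in> \<U>'"
  shows "z \<in> in_charts_dom (cover_chart E U) (cover_chart E' V) f \<longleftrightarrow> z \<in> U \<and> E' (lft z) \<in> E' ` V"
  using assms src.U_Om[OF assms(1)] lift src.U_inj[OF assms(1)]
  unfolding in_charts_dom_def cover_chart_def by (force simp: image_iff)

text \<open>
  Two lifts of the same point differ by a period of the target, and a period is constant near a
  point; hence the map is affine in suitable neighbourhoods, with the same linear part everywhere.
\<close>

lemma in_charts_locally_affine:
  assumes U: "U \<in> \<U>" and V: "V \<in> \<U>'" and z: "z \<in> in_charts_dom (cover_chart E U) (cover_chart E' V) f"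
  obtains d W where "openin (top_of_set (Csp m)) W" "z \<in> W"
    "W \<subseteq> in_charts_dom (cover_chart E U) (cover_chart E' V) f"
    "\<And>w. w \<in> W \<Longrightarrow> in_charts (cover_chart E U) (cover_chart E' V) f w = lin2 1 (lft w) 1 d"
    "\<And>w. w \<in> W \<Longrightarrow> lin2 1 (lft w) 1 d \<in> V \<and> E' (lin2 1 (lft w) 1 d) = E' (lft w)"
proof -
  have zU: "z \<in> U" using in_charts_dom_iff[OF U V] z by auto
  obtain z' where z': "z' \<in> V" "E' z' = E' (lft z)"
    using in_charts_dom_iff[OF U V] z by fastforce
  \<comment> \<open>The period that carries the lifted point into the chosen chart of the target.\<close>
  define d where "d = lin2 1 z' (-1) (lft z)"
  have d: "lin2 1 (lft z) 1 d = z'" by (auto simp: d_def)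
  have Csp: "lft z \<in> Csp m'" "z' \<in> Csp m'"
    using src.U_Om[OF U] zU lift_Om tgt.Om_Csp tgt.U_Om[OF V] z' by blast+
  have dC: "d \<in> Csp m'" unfolding d_def by (rule Csp_lin2[OF Csp(2,1)])
  define W where "W = U \<inter> ((\<lambda>w. lin2 1 (lft w) 1 d) -` V)"
  have "continuous_on U (\<lambda>w. lin2 1 (lft w) 1 d)"
    by (rule continuous_on_subset[OF _ subset_UNIV])
       (intro continuous_on_lin2[of UNIV "\<lambda>_. 1" lft "\<lambda>_. 1" "\<lambda>_. d"] lft_continuous continuous_on_const)
  moreover have "(\<lambda>w. lin2 1 (lft w) 1 d) \<in> U \<rightarrow> Csp m'"
    using src.U_Om[OF U] lift_Om tgt.Om_Csp Csp_lin2[OF _ dC] by blast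
  ultimately have "openin (top_of_set U) W"
    unfolding W_def using tgt.U_open[OF V] by (rule continuous_openin_preimage)
  then have W: "openin (top_of_set (Csp m)) W"
    using src.U_open[OF U] openin_trans by blast
  have zW: "z \<in> W" using zU z' d by (auto simp: W_def)
  have key: "E' (lin2 1 (lft w) 1 d) = E' (lft w)" "lin2 1 (lft w) 1 d \<in> V" if "w \<in> W" for w
  proof -
    show V': "lin2 1 (lft w) 1 d \<in> V" using that by (simp add: W_def)
    show "E' (lin2 1 (lft w) 1 d) = E' (lft w)"
    proof (rule tgt.period[of "lft z"])
      show "lft z \<in> \<Omega>'" "lft w \<in> \<Omega>'" using lift_Om src.U_Om[OF U] zU that by (auto simp: W_def)
      show "lin2 1 (lft w) 1 d \<in> \<Omega>'" using V' tgt.U_Om[OF V] by auto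
      show "lin2 1 (lft z) 1 d \<in> \<Omega>'" "E' (lin2 1 (lft z) 1 d) = E' (lft z)"
        using z' tgt.U_Om[OF V] unfolding d by auto
    qed
  qed
  show thesis
  proof (rule that[OF W zW])
    show "W \<subseteq> in_charts_dom (cover_chart E U) (cover_chart E' V) f"
      using key in_charts_dom_iff[OF U V] unfolding W_def by (metis (no_types, lifting) IntD1 W_def imageI subsetI)
    show "in_charts (cover_chart E U) (cover_chart E' V) f w = lin2 1 (lft w) 1 d" if w: "w \<in> W" for w
    proof -
      have wU: "w \<in> U" using w by (simp add: W_def)
      have "f (E w) = E' (lin2 1 (lft w) 1 d)"
        using lift src.U_Om[OF U] wU key[OF w] by auto
      then show ?thesis
        unfolding in_charts_def src.chart_inv_U[OF U wU]
        by (simp add: cover_chart_def inv_into_f_f[OF tgt.U_inj[OF V] key(2)[OF w]])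
    qed
  qed (use key in auto)
qed

lemma in_charts_dom_open:
  assumes "U \<in> \<U>" "V \<in> \<U>'"
  shows "openin (top_of_set (Csp m)) (in_charts_dom (cover_chart E U) (cover_chart E' V) f)"
  by (subst openin_subopen) (metis in_charts_locally_affine[OF assms])

lemma in_charts_holo:
  assumes U: "U \<in> \<U>" and V: "V \<in> \<U>'"
  shows "holo_on m (in_charts_dom (cover_chart E U) (cover_chart E' V) f) (in_charts (cover_chart E U) (cover_chart E' V) f)"
    and "z \<in> in_charts_dom (cover_chart E U) (cover_chart E' V) f \<Longrightarrow> v \<in> Csp m \<Longrightarrow>
      differential (in_charts (cover_chart E U) (cover_chart E' V) f) z v = L v"
proof -
  have *: "\<exists>e W. openin (top_of_set (Csp m)) W \<and> z \<in> W \<and>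
      (\<forall>w\<in>W. in_charts (cover_chart E U) (cover_chart E' V) f w = lin2 1 e 1 (L w))"
    if "z \<in> in_charts_dom (cover_chart E U) (cover_chart E' V) f" for z
  proof -
    obtain d W where W: "openin (top_of_set (Csp m)) W" "z \<in> W"
      "\<And>w. w \<in> W \<Longrightarrow> in_charts (cover_chart E U) (cover_chart E' V) f w = lin2 1 (lft w) 1 d"
      using in_charts_locally_affine[OF U V \<open>z \<in> _\<close>] by metis
    then show ?thesis
      by (intro exI[of _ "lin2 1 c 1 d"] exI[of _ W]) (auto simp: lin2_def add_ac)
  qed
  note hol = holo_on_locally_affine[OF in_charts_dom_open[OF U V] *]
  show "holo_on m (in_charts_dom (cover_chart E U) (cover_chart E' V) f) (in_charts (cover_chart E U) (cover_chart E' V) f)"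
    using hol(1) by blast
  show "z \<in> in_charts_dom (cover_chart E U) (cover_chart E' V) f \<Longrightarrow> v \<in> Csp m \<Longrightarrow>
      differential (in_charts (cover_chart E U) (cover_chart E' V) f) z v = L v"
    using hol(2) by blast
qed

lemma f_maps: "f ` (E ` \<Omega>) \<subseteq> E' ` \<Omega>'"
  using lift lift_Om by force

end

lemma complex_linear_map_id: "complex_linear_map (\<lambda>v. v)"
  by unfold_locales auto

context affine_cover
begin

lemma affine_cover_map_id: "affine_cover_map m \<Omega> E \<U> m \<Omega> E \<U> (\<lambda>v. v) (\<lambda>x. x) (\<lambda>_. 0)"
proof -
  have "lin2 1 (\<lambda>_. 0) 1 z = z" for z by (auto simp: lin2_def)
  then show ?thesis
    by (intro affine_cover_map.intro affine_cover_axioms complex_linear_map_id affine_cover_map_axioms.intro)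
      (auto simp: Csp_def)
qed

lemma complex_manifold_mfd: "complex_manifold mfd"
proof -
  interpret id: affine_cover_map m \<Omega> E \<U> m \<Omega> E \<U> "\<lambda>v. v" "\<lambda>x. x" "\<lambda>_. 0"
    by (rule affine_cover_map_id)
  have "second_countable (euclidean :: cvec topology)"
  proof -
    obtain B :: "cvec set set" where B: "countable B" "topological_basis B"
      using ex_countable_basis by blast
    have "open = arbitrary union_of (\<lambda>x. x \<in> B)"
    proof (intro ext iffI)
      fix S :: "cvec set" assume "open S"
      then obtain B' where "B' \<subseteq> B" "\<Union>B' = S" using B unfolding topological_basis_def by blast
      then show "(arbitrary union_of (\<lambda>x. x \<in> B)) S" unfolding union_of_def arbitrary_def by blast
    next
      fix S :: "cvec set" assume "(arbitrary union_of (\<lambda>x. x \<in> B)) S"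
      then show "open S"
        using B unfolding union_of_def topological_basis_def by (auto intro!: open_Union)
    qed
    then show ?thesis
      unfolding second_countable using B by (intro exI[of _ B]) (auto simp: fun_eq_iff)
  qed
  moreover have "homeomorphic_map (subtopology (top_of_set (E ` \<Omega>)) (E ` U)) (top_of_set U) (inv_into U E)"
    if U: "U \<in> \<U>" for U
  proof -
    have eq: "subtopology (top_of_set (E ` \<Omega>)) (E ` U) = top_of_set (E ` U)"
      using U_Om[OF U] by (simp add: subtopology_subtopology Int_absorb1 image_mono)
    have "homeomorphic_maps (top_of_set (E ` U)) (top_of_set U) (inv_into U E) E"
      unfolding homeomorphic_maps_def
      using inverse_continuous[OF U] continuous_on_subset[OF E_continuous U_Om[OF U]] U_inj[OF U]
      by (auto simp: inv_into_into f_inv_into_f)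
    then show ?thesis unfolding eq using homeomorphic_maps_map by blast
  qed
  ultimately show ?thesis
    unfolding complex_manifold_def
    using Om_connected E_continuous Union_U EU_open U_open id.in_charts_holo(1)
    by (auto simp: Hausdorff_space_subtopology second_countable_subtopology connected_space_subtopology
        connected_continuous_image cover_chart_def[of E U for U, THEN arg_cong[of _ _ fst]]
        cover_chart_def[of E U for U, THEN arg_cong[of _ _ snd]])
qed

end

context affine_cover_map
begin

lemma holomorphic_map_f: "holomorphic_map src.mfd tgt.mfd f"
proof -
  have "continuous_on (E ` \<Omega>) f"
    unfolding continuous_on_open_gen[OF f_maps[unfolded image_subset_iff_funcset]]
  proof (intro allI impI)
    fix V assume V: "openin (top_of_set (E' ` \<Omega>')) V"
    show "openin (top_of_set (E ` \<Omega>)) (E ` \<Omega> \<inter> f -` V)"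
    proof (subst openin_subopen, intro ballI)
      fix x assume x: "x \<in> E ` \<Omega> \<inter> f -` V"
      then obtain z U where z: "x = E z" "U \<in> \<U>" "z \<in> U" using src.Union_U by auto
      have sub: "U \<subseteq> \<Omega>" using z src.U_Om by auto
      have cont: "continuous_on (E ` U) (\<lambda>x. E' (lft (inv_into U E x)))"
      proof (rule continuous_on_compose2[of "\<Omega>'" E'])
        show "continuous_on (E ` U) (\<lambda>x. lft (inv_into U E x))"
          by (rule continuous_on_compose2[OF lft_continuous src.inverse_continuous]) (use z in auto)
        show "(\<lambda>x. lft (inv_into U E x)) ` E ` U \<subseteq> \<Omega>'"
          using lift_Om sub src.U_inj[OF z(2)] by (auto simp: inv_into_f_f)
      qed (rule tgt.E_continuous)
      have eq: "E' (lft (inv_into U E y)) = f y" if "y \<in> E ` U" for y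
        using that lift sub src.U_inj[OF z(2)] by (auto simp: inv_into_f_f)
      have "continuous_on (E ` U) f" using cont eq by (simp cong: continuous_on_cong)
      then have "openin (top_of_set (E ` U)) (E ` U \<inter> f -` V)"
        by (rule continuous_openin_preimage[OF _ _ V]) (use f_maps sub in blast)
      then have "openin (top_of_set (E ` \<Omega>)) (E ` U \<inter> f -` V)"
        using src.EU_open[OF z(2)] openin_trans by blast
      then show "\<exists>T. openin (top_of_set (E ` \<Omega>)) T \<and> x \<in> T \<and> T \<subseteq> E ` \<Omega> \<inter> f -` V"
        using x z sub by (intro exI[of _ "E ` U \<inter> f -` V"]) auto
    qed
  qed
  then show ?thesis
    unfolding holomorphic_map_def using f_maps in_charts_holo(1) by auto
qed

lemma immersion_f: "inj_on L (Csp m) \<Longrightarrow> immersion src.mfd tgt.mfd f"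
  unfolding immersion_def src.mfd_simps tgt.mfd_simps ball_simps(9)
  by (intro ballI) (simp add: in_charts_holo(2) cong: inj_on_cong)

lemma submersion_f: "L ` Csp m = Csp m' \<Longrightarrow> submersion src.mfd tgt.mfd f"
  unfolding submersion_def src.mfd_simps tgt.mfd_simps ball_simps(9)
  by (intro ballI) (simp add: in_charts_holo(2) cong: image_cong)

end

section \<open>Forms in lifted coordinates\<close>

lemma pair_listE:
  assumes "length vs = 2"
  obtains v w where "vs = [v, w]"
  using assms by (cases vs; cases "tl vs") auto

lemma triple_listE:
  assumes "length vs = 3"
  obtains u v w where "vs = [u, v, w]"
  using assms by (cases vs; cases "tl vs"; cases "tl (tl vs)") auto

lemma ext_d_pair:
  "ext_d \<alpha> C z [v, w] = dir_deriv v (\<lambda>u. \<alpha> C u [w]) z - dir_deriv w (\<lambda>u. \<alpha> C u [v]) z"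
  by (simp add: ext_d_def lessThan_Suc numeral_2_eq_2)

lemma ext_d_triple:
  "ext_d \<alpha> C z [u, v, w] = dir_deriv u (\<lambda>x. \<alpha> C x [v, w]) z - dir_deriv v (\<lambda>x. \<alpha> C x [u, w]) z
     + dir_deriv w (\<lambda>x. \<alpha> C x [u, v]) z"
  by (simp add: ext_d_def lessThan_Suc)

lemma dc_single: "dc f C z [v] = - dir_deriv (Jop v) (\<lambda>u. f C u []) z"
  by (simp add: dc_def ext_d_def)

lemma dir_deriv_minus: "dir_deriv v (\<lambda>u. - f u :: real) z = - dir_deriv v f z"
  if f: "f \<in> trig_poly"
proof -
  obtain D where D: "\<And>z. ((\<lambda>t::real. f (lin2 1 z t v)) has_real_derivative D z) (at 0)"
    using trig_poly_derivation[OF f] by blast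
  show ?thesis
    using dir_derivI_real[OF D] dir_derivI_real[of "\<lambda>u. - f u", OF DERIV_minus[OF D]] by simp
qed

text \<open>
  Since \<open>dd\<^sup>c\<close> depends only on germs, it may be computed for a globally defined function that
  agrees with the given one near the point.
\<close>

lemma ddc_local:
  assumes U: "openin (top_of_set (Csp m)) U" "z \<in> U" and h: "h \<in> trig_poly"
    and eq: "\<And>w. w \<in> U \<Longrightarrow> f C w [] = h w" and vw: "v \<in> Csp m" "w \<in> Csp m"
  shows "ddc f C z [v, w] =
    dir_deriv w (dir_deriv (Jop v) h) z - dir_deriv v (dir_deriv (Jop w) h) z"
proof -
  have D: "dir_deriv x (\<lambda>u. dc f C u [y]) z = - dir_deriv x (dir_deriv (Jop y) h) z"
    if "x \<in> Csp m" "y \<in> Csp m" for x y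
  proof -
    have "dir_deriv x (\<lambda>u. dc f C u [y]) z = dir_deriv x (\<lambda>u. - dir_deriv (Jop y) h u) z"
    proof (rule dir_deriv_local[OF U that(1)])
      fix u assume u: "u \<in> U"
      show "dc f C u [y] = - dir_deriv (Jop y) h u"
        unfolding dc_single using dir_deriv_local[OF U(1) u Csp_Jop[OF that(2)], of "\<lambda>u. f C u []" h] eq by simp
    qed
    also have "\<dots> = - dir_deriv x (dir_deriv (Jop y) h) z"
      using derivation_closed_trig_poly h by (intro dir_deriv_minus) (auto simp: derivation_closed_def)
    finally show ?thesis .
  qed
  show ?thesis unfolding ddc_def ext_d_pair by (simp add: D vw)
qed

text \<open>
  With \<open>\<omega>\<close> antisymmetric the two permutations of the arguments contribute equally, which cancels the
  factor \<open>1/2\<close>.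
\<close>

lemma wedge_power_1:
  assumes "\<omega> C z [w, v] = - \<omega> C z [v, w]"
  shows "wedge_power 1 \<omega> C z [v, w] = \<omega> C z [v, w]"
proof -
  define \<tau> where "\<tau> = Transposition.transpose 0 (1::nat)"
  have perms: "{\<sigma>. \<sigma> permutes {..<2 * (1::nat)}} = {id, \<tau>}"
  proof -
    have "{..<2 * (1::nat)} = {0, 1}" by auto
    then show ?thesis by (auto simp only: permutes_doubleton_iff \<tau>_def)
  qed
  have "\<tau> 0 \<noteq> id 0" by (simp add: \<tau>_def)
  then have "id \<noteq> \<tau>" by metis
  moreover have "sign \<tau> = -1" by (simp add: \<tau>_def sign_swap_id)
  ultimately show ?thesis
    unfolding wedge_power_def perms using assms by (simp add: \<tau>_def)
qed

context affine_cover
begin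

text \<open>
  In lifted coordinates a form on the quotient has one expression \<open>B\<close> for all charts.  As a form is
  significant only on the images of charts, properties of forms are transported along \<open>represents\<close>
  instead of along equality.
\<close>

definition represents :: "cvec form \<Rightarrow> (cvec \<Rightarrow> cvec \<Rightarrow> cvec \<Rightarrow> real) \<Rightarrow> bool" where
  "represents \<alpha> B \<longleftrightarrow> (\<forall>U\<in>\<U>. \<forall>z\<in>U. \<forall>v\<in>Csp m. \<forall>w\<in>Csp m. \<alpha> (cover_chart E U) z [v, w] = B z v w)"

text \<open>
  The last clause, invariance under the periods, is what makes \<open>B\<close> compatible with changes of
  charts.  Linearity in the second argument follows from antisymmetry.
\<close>

definition real_1_1 :: "(cvec \<Rightarrow> cvec \<Rightarrow> cvec \<Rightarrow> real) \<Rightarrow> bool" where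
  "real_1_1 B \<longleftrightarrow>
     (\<forall>z a v b w x. B z (lin2 a v b w) x = a * B z v x + b * B z w x) \<and>
     (\<forall>z v w. B z w v = - B z v w) \<and> (\<forall>z v w. B z (Jop v) (Jop w) = B z v w) \<and>
     (\<forall>v w. (\<lambda>z. B z v w) \<in> trig_poly) \<and>
     (\<forall>z\<in>\<Omega>. \<forall>z'\<in>\<Omega>. E z = E z' \<longrightarrow> B z = B z')"

lemma real_1_1D:
  assumes "real_1_1 B"
  shows "B z (lin2 a v b w) x = a * B z v x + b * B z w x" "B z w v = - B z v w"
    "B z (Jop v) (Jop w) = B z v w" "(\<lambda>z. B z v w) \<in> trig_poly"
    "y \<in> \<Omega> \<Longrightarrow> y' \<in> \<Omega> \<Longrightarrow> E y = E y' \<Longrightarrow> B y = B y'"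
  using assms unfolding real_1_1_def by blast+

lemma representsD: "represents \<alpha> B \<Longrightarrow> U \<in> \<U> \<Longrightarrow> z \<in> U \<Longrightarrow> v \<in> Csp m \<Longrightarrow> w \<in> Csp m \<Longrightarrow>
    \<alpha> (cover_chart E U) z [v, w] = B z v w"
  by (auto simp: represents_def)

text \<open>
  A change of charts is locally a translation by a period: its differential is the identity and
  \<open>B\<close> does not see the translation.
\<close>

lemma smooth_form_represents:
  assumes rep: "represents \<alpha> B" and B: "real_1_1 B"
  shows "smooth_form mfd 2 \<alpha>"
proof -
  interpret id: affine_cover_map m \<Omega> E \<U> m \<Omega> E \<U> "\<lambda>v. v" "\<lambda>x. x" "\<lambda>_. 0"
    by (rule affine_cover_map_id)
  have lin1: "B z (lin2 a v b w) x = a * B z v x + b * B z w x" for z a v b w x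
    by (rule real_1_1D(1)[OF B])
  have anti: "B z w v = - B z v w" for z v w by (rule real_1_1D(2)[OF B])
  have lin2: "B z x (lin2 a v b w) = a * B z x v + b * B z x w" for z a v b w x
    unfolding anti[of z x] lin1 by simp
  have self: "B z v v = 0" for z v using anti[of z v v] by simp
  have tp: "(\<lambda>z. B z v w) \<in> trig_poly" for v w by (rule real_1_1D(4)[OF B])
  have lft: "id.lft z = z" for z by (auto simp: lin2_def)
  have trans: "\<alpha> (cover_chart E U) z [v, w] = \<alpha> (cover_chart E V) (in_charts (cover_chart E U) (cover_chart E V) (\<lambda>x. x) z)
       (map (differential (in_charts (cover_chart E U) (cover_chart E V) (\<lambda>x. x)) z) [v, w])"
    if UV: "U \<in> \<U>" "V \<in> \<U>" and z: "z \<in> in_charts_dom (cover_chart E U) (cover_chart E V) (\<lambda>x. x)"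
      and vw: "v \<in> Csp m" "w \<in> Csp m" for U V z v w
  proof -
    obtain d W where W: "z \<in> W" "\<And>w. w \<in> W \<Longrightarrow> in_charts (cover_chart E U) (cover_chart E V) (\<lambda>x. x) w = lin2 1 (id.lft w) 1 d"
     "\<And>w. w \<in> W \<Longrightarrow> lin2 1 (id.lft w) 1 d \<in> V \<and> E (lin2 1 (id.lft w) 1 d) = E (id.lft w)"
      using id.in_charts_locally_affine[OF UV z] by metis
    define z' where "z' = in_charts (cover_chart E U) (cover_chart E V) (\<lambda>x. x) z"
    have z': "z' \<in> V" "E z' = E z" using W unfolding z'_def by (simp_all add: lft)
    have zU: "z \<in> U" using id.in_charts_dom_iff[OF UV] z by auto
    have "B z' = B z" using real_1_1D(5)[OF B, of z' z] z' zU U_Om UV by auto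
    then show ?thesis
      using representsD[OF rep UV(1) zU vw] representsD[OF rep UV(2) z'(1) vw]
        id.in_charts_holo(2)[OF UV z] vw
      unfolding z'_def[symmetric] by simp
  qed
  show ?thesis
    unfolding smooth_form_def mfd_simps ball_simps(9)
  proof (intro conjI ballI)
    fix U vs assume U: "U \<in> \<U>" and vs: "vs \<in> tangent_lists mfd 2"
    obtain v w where vw: "vs = [v, w]" using vs by (auto simp: tangent_lists_def elim: pair_listE)
    have C: "v \<in> Csp m" "w \<in> Csp m" using vs by (auto simp: tangent_lists_def vw)
    show "smooth_on m (chart_image (cover_chart E U)) (\<lambda>z. \<alpha> (cover_chart E U) z vs)"
      using smooth_on_trig_poly[OF U_open[OF U] tp] representsD[OF rep U _ C] by (simp add: U vw)
    fix z assume "z \<in> chart_image (cover_chart E U)"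
    then have z: "z \<in> U" using U by simp
    note r = representsD[OF rep U z]
    show "\<forall>i<2. \<forall>v\<in>Csp m. \<forall>w\<in>Csp m. \<forall>a b. \<alpha> (cover_chart E U) z (vs[i := lin2 a v b w]) =
        a * \<alpha> (cover_chart E U) z (vs[i := v]) + b * \<alpha> (cover_chart E U) z (vs[i := w])"
      unfolding vw using C
      by (auto simp: less_2_cases_iff r Csp_lin2 lin1 lin2 simp del: lin2_apply)
    show "\<forall>i<2. \<forall>j<2. i \<noteq> j \<and> vs ! i = vs ! j \<longrightarrow> \<alpha> (cover_chart E U) z vs = 0"
      unfolding vw using C by (auto simp: less_2_cases_iff r self)
  next
    fix U V z vs assume *: "U \<in> \<U>" "V \<in> \<U>" "z \<in> in_charts_dom (cover_chart E U) (cover_chart E V) (\<lambda>x. x)"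
      and vs: "vs \<in> tangent_lists mfd 2"
    obtain v w where vw: "vs = [v, w]" using vs by (auto simp: tangent_lists_def elim: pair_listE)
    have C: "v \<in> Csp m" "w \<in> Csp m" using vs by (auto simp: tangent_lists_def vw)
    show "\<alpha> (cover_chart E U) z vs = \<alpha> (cover_chart E V) (in_charts (cover_chart E U) (cover_chart E V) (\<lambda>x. x) z)
       (map (differential (in_charts (cover_chart E U) (cover_chart E V) (\<lambda>x. x)) z) vs)"
      unfolding vw by (rule trans[OF * C])
  qed
qed

lemma hermitian_form_represents:
  assumes rep: "represents \<alpha> B" and B: "real_1_1 B"
    and pos: "\<And>z v. z \<in> \<Omega> \<Longrightarrow> v \<in> Csp m \<Longrightarrow> v \<noteq> (\<lambda>_. 0) \<Longrightarrow> B z v (Jop v) > 0"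
  shows "hermitian_form mfd \<alpha>"
  unfolding hermitian_form_def type_1_1_def positive_form_def
  using smooth_form_represents[OF rep B] representsD[OF rep] Csp_Jop real_1_1D(3)[OF B] pos U_Om
  by (auto simp: subset_iff)

lemma kahler_form_represents:
  assumes rep: "represents \<alpha> B" and B: "real_1_1 B"
    and pos: "\<And>z v. z \<in> \<Omega> \<Longrightarrow> v \<in> Csp m \<Longrightarrow> v \<noteq> (\<lambda>_. 0) \<Longrightarrow> B z v (Jop v) > 0"
    and closed: "\<And>z u v w. dir_deriv u (\<lambda>x. B x v w) z - dir_deriv v (\<lambda>x. B x u w) z
      + dir_deriv w (\<lambda>x. B x u v) z = 0"
  shows "kahler_form mfd \<alpha>"
proof -
  have D: "dir_deriv u (\<lambda>x. \<alpha> (cover_chart E U) x [v, w]) z = dir_deriv u (\<lambda>x. B x v w) z"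
    if "U \<in> \<U>" "z \<in> U" "u \<in> Csp m" "v \<in> Csp m" "w \<in> Csp m" for U z u v w
    by (rule dir_deriv_local[OF U_open[OF that(1)] that(2,3)]) (rule representsD[OF rep that(1) _ that(4,5)])
  have "form_eq mfd 3 (ext_d \<alpha>) zero_form"
    unfolding form_eq_def mfd_simps ball_simps(9)
  proof (intro ballI)
    fix U z vs assume U: "U \<in> \<U>" and "z \<in> chart_image (cover_chart E U)" and vs: "vs \<in> tangent_lists mfd 3"
    then have z: "z \<in> U" by simp
    obtain u v w where uvw: "vs = [u, v, w]" using vs by (auto simp: tangent_lists_def elim: triple_listE)
    have C: "u \<in> Csp m" "v \<in> Csp m" "w \<in> Csp m" using vs by (auto simp: tangent_lists_def uvw)
    show "ext_d \<alpha> (cover_chart E U) z vs = zero_form (cover_chart E U) z vs"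
      unfolding uvw ext_d_triple zero_form_def D[OF U z C] D[OF U z C(2,1,3)] D[OF U z C(3,1,2)]
      by (rule closed)
  qed
  then show ?thesis
    unfolding kahler_form_def using hermitian_form_represents[OF rep B pos] by blast
qed

lemma represents_add:
  "represents \<alpha> B \<Longrightarrow> represents \<beta> B' \<Longrightarrow> represents (add_form \<alpha> \<beta>) (\<lambda>z v w. B z v w + B' z v w)"
  by (simp add: represents_def add_form_def)

lemma represents_ddc:
  assumes "h \<in> trig_poly" "\<And>z. z \<in> \<Omega> \<Longrightarrow> \<phi> (E z) = h z"
  shows "represents (ddc (fun_form \<phi>))
    (\<lambda>z v w. dir_deriv w (dir_deriv (Jop v) h) z - dir_deriv v (dir_deriv (Jop w) h) z)"
  unfolding represents_def
proof (intro ballI)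
  fix U z v w assume U: "U \<in> \<U>" and *: "z \<in> U" "v \<in> Csp m" "w \<in> Csp m"
  show "ddc (fun_form \<phi>) (cover_chart E U) z [v, w] =
      dir_deriv w (dir_deriv (Jop v) h) z - dir_deriv v (dir_deriv (Jop w) h) z"
    by (rule ddc_local[OF U_open[OF U] *(1) assms(1) _ *(2,3)])
      (use U U_Om[OF U] assms(2) in \<open>auto simp: fun_form_def subset_iff\<close>)
qed

lemma smooth_fun_represents:
  assumes "h \<in> trig_poly" "\<And>z. z \<in> \<Omega> \<Longrightarrow> \<phi> (E z) = h z"
  shows "smooth_fun mfd \<phi>"
  unfolding smooth_fun_def mfd_simps ball_simps(9)
proof
  fix U assume U: "U \<in> \<U>"
  show "smooth_on m (chart_image (cover_chart E U)) (\<lambda>z. \<phi> (chart_inv (cover_chart E U) z))"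
    unfolding chart_image_U[OF U]
    by (rule smooth_on_trig_poly[OF U_open[OF U] assms(1)]) (use U U_Om[OF U] assms(2) in \<open>auto simp: subset_iff\<close>)
qed

lemma frame_1: "std_frame 1 = [cunit 0, Jop (cunit 0)]"
  by (simp add: std_frame_def)

lemma cunit_Csp: "j < m \<Longrightarrow> cunit j \<in> Csp m"
  by (auto simp: cunit_def Csp_def)

lemma wedge_power_represents:
  assumes "m = 1" "represents \<alpha> B" "real_1_1 B" "U \<in> \<U>" "z \<in> U"
  shows "wedge_power 1 \<alpha> (cover_chart E U) z (std_frame 1) = B z (cunit 0) (Jop (cunit 0))"
proof -
  have C: "cunit 0 \<in> Csp m" "Jop (cunit 0) \<in> Csp m"
    using cunit_Csp[of 0] Csp_Jop assms(1) by auto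
  show ?thesis
    unfolding frame_1
    by (subst wedge_power_1) (simp_all add: representsD[OF assms(2,4,5)] C real_1_1D(2)[OF assms(3), of z "Jop (cunit 0)"])
qed

lemma ricci_form_constant:
  assumes m: "m = 1" and rep: "represents \<alpha> B" and B: "real_1_1 B"
    and const: "\<And>z. z \<in> \<Omega> \<Longrightarrow> B z (cunit 0) (Jop (cunit 0)) = b"
  shows "form_eq mfd 2 (ricci_form mfd \<alpha>) zero_form"
  unfolding form_eq_def mfd_simps ball_simps(9)
proof (intro ballI)
  fix U z vs assume U: "U \<in> \<U>" and "z \<in> chart_image (cover_chart E U)" and vs: "vs \<in> tangent_lists mfd 2"
  then have z: "z \<in> U" by simp
  obtain v w where vw: "vs = [v, w]" using vs by (auto simp: tangent_lists_def elim: pair_listE)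
  have C: "v \<in> Csp m" "w \<in> Csp m" using vs by (auto simp: tangent_lists_def vw)
  have dens: "log_density mfd \<alpha> (cover_chart E U) u [] = ln b" if "u \<in> U" for u
  proof -
    have dim: "mdim mfd = 1" unfolding mfd_simps by (rule m)
    have "u \<in> \<Omega>" using U_Om[OF U] that by auto
    then show ?thesis
      unfolding log_density_def dim wedge_power_represents[OF m rep B U that] by (simp add: const)
  qed
  have "dir_deriv v (\<lambda>_. ln b) = (\<lambda>_. 0)" for v by auto
  then have "ddc (log_density mfd \<alpha>) (cover_chart E U) z [v, w] = 0"
    using ddc_local[OF U_open[OF U] z trig_poly.const[of "ln b"] _ C, of "log_density mfd \<alpha>"] dens by simp
  then show "ricci_form mfd \<alpha> (cover_chart E U) z vs = zero_form (cover_chart E U) z vs"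
    by (simp add: ricci_form_def scale_form_def zero_form_def vw)
qed

text \<open>
  A metric with constant density is its own witness: its Chern form vanishes identically.
\<close>

lemma c1_zero_mfd:
  assumes m: "m = 1" and rep: "represents \<alpha> B" and B: "real_1_1 B"
    and pos: "\<And>z v. z \<in> \<Omega> \<Longrightarrow> v \<in> Csp m \<Longrightarrow> v \<noteq> (\<lambda>_. 0) \<Longrightarrow> B z v (Jop v) > 0"
    and const: "\<And>z. z \<in> \<Omega> \<Longrightarrow> B z (cunit 0) (Jop (cunit 0)) = b"
  shows "c1_zero mfd"
proof -
  have "smooth_form mfd 1 zero_form"
    unfolding smooth_form_def zero_form_def
    using smooth_on_trig_poly[OF U_open trig_poly.const[of 0]] by auto
  moreover have "ext_d (zero_form :: cvec form) = zero_form"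
    by (auto simp: fun_eq_iff ext_d_def zero_form_def)
  moreover have "form_eq mfd 2 (chern_form mfd \<alpha>) zero_form"
    using ricci_form_constant[OF m rep B const]
    unfolding form_eq_def chern_form_def scale_form_def zero_form_def by simp
  ultimately have "exact_form mfd 2 (chern_form mfd \<alpha>)"
    unfolding exact_form_def by (intro exI[of _ zero_form]) simp
  then show ?thesis
    unfolding c1_zero_def using hermitian_form_represents[OF rep B pos] by blast
qed

end

context affine_cover_map
begin

text \<open>
  The chart of the target that enters the pullback is arbitrary; the coordinates that it yields
  differ from the lift by a period, which \<open>B\<close> does not see.
\<close>

lemma represents_pullback:
  assumes rep: "tgt.represents \<alpha> B" and B: "tgt.real_1_1 B"
  shows "src.represents (pullback tgt.mfd f \<alpha>) (\<lambda>z v w. B (lft z) (L v) (L w))"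
  unfolding src.represents_def
proof (intro ballI)
  fix U z v w assume U: "U \<in> \<U>" and z: "z \<in> U" and vw: "v \<in> Csp m" "w \<in> Csp m"
  let ?C = "cover_chart E U"
  have zO: "z \<in> \<Omega>" using U z src.U_Om by auto
  define D where "D = (SOME D. D \<in> atlas tgt.mfd \<and> f (chart_inv ?C z) \<in> fst D)"
  have inv: "chart_inv ?C z = E z" using U z by simp
  have "\<exists>D. D \<in> atlas tgt.mfd \<and> f (chart_inv ?C z) \<in> fst D"
    unfolding inv lift[OF zO] using lift_Om[OF zO] tgt.Union_U
    by (auto simp: cover_chart_def)
  then have "D \<in> atlas tgt.mfd \<and> f (chart_inv ?C z) \<in> fst D"
    unfolding D_def by (rule someI_ex)
  then obtain V where V: "V \<in> \<U>'" "D = cover_chart E' V" "f (E z) \<in> E' ` V"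
    unfolding inv by (auto simp: cover_chart_def)
  have dom: "z \<in> in_charts_dom ?C (cover_chart E' V) f"
    using in_charts_dom_iff[OF U V(1)] V(3) z lift[OF zO] by auto
  obtain d W where W: "z \<in> W" "\<And>w. w \<in> W \<Longrightarrow> in_charts ?C (cover_chart E' V) f w = lin2 1 (lft w) 1 d"
     "\<And>w. w \<in> W \<Longrightarrow> lin2 1 (lft w) 1 d \<in> V \<and> E' (lin2 1 (lft w) 1 d) = E' (lft w)"
    using in_charts_locally_affine[OF U V(1) dom] by metis
  define z' where "z' = in_charts ?C (cover_chart E' V) f z"
  have z': "z' \<in> V" "E' z' = E' (lft z)" using W unfolding z'_def by simp_all
  have "B z' = B (lft z)"
    using tgt.real_1_1D(5)[OF B, of z' "lft z"] z' tgt.U_Om[OF V(1)] lift_Om[OF zO] by auto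
  moreover have "pullback tgt.mfd f \<alpha> ?C z [v, w] = \<alpha> D z' [L v, L w]"
    unfolding pullback_def Let_def D_def[symmetric] V(2) z'_def
    by (simp add: in_charts_holo(2)[OF U V(1) dom] vw)
  ultimately show "pullback tgt.mfd f \<alpha> ?C z [v, w] = B (lft z) (L v) (L w)"
    using tgt.representsD[OF rep V(1) z'(1)] L_Csp vw V(2) by simp
qed

end

section \<open>Torus fibrations\<close>

text \<open>
  The torus is realised as a product of two unit circles.  The same family of coverings serves the
  total space, with \<open>m = 2\<close> and \<open>c = 0\<close>, and its fibre over \<open>c\<close>, with \<open>m = 1\<close>: in the latter case
  the coordinate \<open>z 1\<close> vanishes.
\<close>

definition torus_cover :: "complex \<Rightarrow> cvec \<Rightarrow> cvec" where
  "torus_cover c z = (\<lambda>i. if i = 0 then cis (Re (z 0)) else if i = 1 then cis (Im (z 0))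
     else if i = 2 then c + z 1 else 0)"

definition torus_dom :: "nat \<Rightarrow> cvec set" where
  "torus_dom m = {z \<in> Csp m. cmod (z 1) < 1}"

text \<open>
  The fundamental squares centred at arbitrary points.
\<close>

definition window :: "nat \<Rightarrow> real \<Rightarrow> real \<Rightarrow> cvec set" where
  "window m a b = {z \<in> torus_dom m. \<bar>Re (z 0) - a\<bar> < pi \<and> \<bar>Im (z 0) - b\<bar> < pi}"

definition windows :: "nat \<Rightarrow> cvec set set" where
  "windows m = range (\<lambda>(a, b). window m a b)"

definition window_inverse :: "complex \<Rightarrow> real \<Rightarrow> real \<Rightarrow> cvec \<Rightarrow> cvec" where
  "window_inverse c a b x = (\<lambda>i. if i = 0 then Complex (a + Arg (x 0 * cis (- a))) (b + Arg (x 1 * cis (- b)))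
     else if i = 1 then x 2 - c else 0)"

lemma Arg_cis_window: "\<bar>x - a\<bar> < pi \<Longrightarrow> Arg (cis x * cis (- a)) = x - a"
  by (subst cis_mult, subst Arg_cis) auto

lemma Arg_less_pi:
  assumes "cmod u = 1"
  shows "u \<notin> \<real>\<^sub>\<le>\<^sub>0 \<longleftrightarrow> \<bar>Arg u\<bar> < pi"
proof -
  have "u \<in> \<real>\<^sub>\<le>\<^sub>0 \<longleftrightarrow> Re u < 0 \<and> Im u = 0"
    using assms by (auto simp: complex_nonpos_Reals_iff cmod_def intro: order.not_eq_order_implies_strict)
  also have "\<dots> \<longleftrightarrow> Arg u = pi" by (simp add: Arg_eq_pi)
  finally show ?thesis using Arg_bounded[of u] by auto
qed

lemma cis_Arg_unit: "cmod u = 1 \<Longrightarrow> cis (Arg u) = u"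
  by (metis cis_Arg div_by_1 norm_zero of_real_1 sgn_eq zero_neq_one)

lemma cis_window_slit: "\<bar>x - a\<bar> < pi \<Longrightarrow> cis x * cis (- a) \<notin> \<real>\<^sub>\<le>\<^sub>0"
  by (subst Arg_less_pi) (simp_all add: Arg_cis_window norm_mult)

lemma continuous_on_coordinate [continuous_intros]: "continuous_on S (\<lambda>x::cvec. x i)"
  by (rule continuous_on_subset[OF continuous_on_product_coordinates]) simp

lemma continuous_on_if_const:
  "(P \<Longrightarrow> continuous_on S f) \<Longrightarrow> (\<not> P \<Longrightarrow> continuous_on S g) \<Longrightarrow> continuous_on S (\<lambda>x. if P then f x else g x)"
  by (cases P) simp_all

lemma star_connected:
  assumes "\<And>z s. z \<in> S \<Longrightarrow> 0 \<le> s \<Longrightarrow> s \<le> 1 \<Longrightarrow> lin2 s z 0 z \<in> S"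
  shows "connected (S :: cvec set)"
proof -
  have "S = (\<Union>z\<in>S. (\<lambda>s. lin2 s z 0 z) ` {0..1})" (is "_ = ?R")
  proof
    have "z = lin2 1 z 0 z" for z by (auto simp: lin2_def)
    then show "S \<subseteq> ?R" by (force simp: image_iff)
    show "?R \<subseteq> S" using assms by auto
  qed
  moreover have "connected ?R"
  proof (rule connected_Union)
    fix T assume "T \<in> (\<lambda>z. (\<lambda>s. lin2 s z 0 z) ` {0..1}) ` S"
    then show "connected T"
      by (auto intro!: connected_continuous_image continuous_on_lin2 continuous_intros)
  next
    have "(\<lambda>_. 0) \<in> (\<lambda>s. lin2 s z 0 z) ` {0..1}" for z
      by (auto simp: lin2_def image_iff intro!: bexI[of _ 0])
    then show "\<Inter> ((\<lambda>z. (\<lambda>s. lin2 s z 0 z) ` {0..1}) ` S) \<noteq> {}" by blast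
  qed
  ultimately show ?thesis by simp
qed

lemma torus_cover_simps [simp]:
  "torus_cover c z 0 = cis (Re (z 0))" "torus_cover c z (Suc 0) = cis (Im (z 0))"
  "torus_cover c z 2 = c + z 1"
  by (auto simp: torus_cover_def)

lemma window_inverse_torus_cover:
  assumes "z \<in> window m a b" "m \<le> 2"
  shows "window_inverse c a b (torus_cover c z) = z"
proof
  fix i
  have "z i = 0" if "i \<ge> 2" using assms that by (auto simp: window_def torus_dom_def Csp_def)
  then show "window_inverse c a b (torus_cover c z) i = z i"
    using assms by (auto simp: window_inverse_def window_def Arg_cis_window)
qed

lemma cis_Arg_shift: "cmod u = 1 \<Longrightarrow> cis (a + Arg (u * cis (- a))) = u"
proof -
  assume u: "cmod u = 1"
  have "cis a * (u * cis (- a)) = u * (cis a * cis (- a))" by (simp add: mult_ac)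
  then show ?thesis using u by (simp add: cis_mult[symmetric] cis_Arg_unit norm_mult) (simp add: cis_mult)
qed

lemma torus_cover_image_window:
  assumes m: "1 \<le> m" "m \<le> 2"
  shows "torus_cover c ` window m a b =
    {x \<in> torus_cover c ` torus_dom m. x 0 * cis (- a) \<notin> \<real>\<^sub>\<le>\<^sub>0 \<and> x 1 * cis (- b) \<notin> \<real>\<^sub>\<le>\<^sub>0}" (is "?L = ?R")
proof
  show "?L \<subseteq> ?R"
    by (auto simp: window_def dest: cis_window_slit)
  show "?R \<subseteq> ?L"
  proof
    fix x assume x: "x \<in> ?R"
    then obtain z where z: "z \<in> torus_dom m" "x = torus_cover c z" by auto
    have [simp]: "cmod (x 0) = 1" "cmod (x (Suc 0)) = 1" using z by auto
    define z' where "z' = window_inverse c a b x"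
    have "z' \<in> torus_dom m"
      using z m by (auto simp: z'_def window_inverse_def torus_dom_def Csp_def)
    then have "z' \<in> window m a b"
      using x by (auto simp: window_def z'_def window_inverse_def Arg_less_pi norm_mult)
    moreover have "torus_cover c z' i = x i" for i
    proof -
      have "x i = 0" if "i \<noteq> 0" "i \<noteq> 1" "i \<noteq> 2" using that by (simp add: z torus_cover_def)
      then show ?thesis
        by (simp add: torus_cover_def z'_def window_inverse_def cis_Arg_shift)
    qed
    then have "torus_cover c z' = x" ..
    ultimately show "x \<in> ?L" by blast
  qed
qed

lemma torus_dom_scale: "z \<in> torus_dom m \<Longrightarrow> 0 \<le> s \<Longrightarrow> s \<le> 1 \<Longrightarrow> lin2 s z 0 z \<in> torus_dom m"
  by (auto simp: torus_dom_def Csp_def norm_mult intro: le_less_trans[OF mult_left_le_one_le])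

lemma torus_dom_connected: "connected (torus_dom m)"
  by (rule star_connected) (rule torus_dom_scale)

text \<open>
  The image of a window is the set of points that avoid two slits, where the argument function is
  continuous and gives the inverse.
\<close>

lemma affine_cover_torus:
  assumes m: "1 \<le> m" "m \<le> 2"
  shows "affine_cover m (torus_dom m) (torus_cover c) (windows m)"
proof
  show "torus_dom m \<subseteq> Csp m" by (auto simp: torus_dom_def)
  show "connected (torus_dom m)" by (rule torus_dom_connected)
  show "continuous_on (torus_dom m) (torus_cover c)"
    unfolding torus_cover_def
    by (rule continuous_on_coordinatewise_then_product) (auto intro!: continuous_intros continuous_on_if_const)
  show "\<Union> (windows m) = torus_dom m"
  proof
    show "\<Union> (windows m) \<subseteq> torus_dom m" by (auto simp: windows_def window_def)
    have "z \<in> window m (Re (z 0)) (Im (z 0))" if "z \<in> torus_dom m" for z using that by (simp add: window_def)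
    then show "torus_dom m \<subseteq> \<Union> (windows m)" unfolding windows_def by blast
  qed
  show "torus_cover c (lin2 1 w 1 d) = torus_cover c w"
    if z: "torus_cover c (lin2 1 z 1 d) = torus_cover c z" for z w d
  proof -
    have "cis (Re (z 0)) * cis (Re (d 0)) = cis (Re (z 0))" "cis (Im (z 0)) * cis (Im (d 0)) = cis (Im (z 0))"
      "d 1 = 0"
      using fun_cong[OF z, of 0] fun_cong[OF z, of 1] fun_cong[OF z, of 2]
      by (auto simp: cis_mult)
    then have "cis (Re (d 0)) = 1" "cis (Im (d 0)) = 1" "d 1 = 0" by auto
    then show ?thesis
      unfolding torus_cover_def by (auto simp: cis_mult[symmetric])
  qed
  fix U assume "U \<in> windows m"
  then obtain a b where U: "U = window m a b" by (auto simp: windows_def)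
  have inv: "window_inverse c a b (torus_cover c z) = z" if "z \<in> U" for z
    using window_inverse_torus_cover that m U by auto
  show "openin (top_of_set (Csp m)) U"
  proof -
    have "open {z::cvec. cmod (z 1) < 1 \<and> \<bar>Re (z 0) - a\<bar> < pi \<and> \<bar>Im (z 0) - b\<bar> < pi}"
      by (intro open_Collect_conj open_Collect_less continuous_intros)
    moreover have "U = Csp m \<inter> {z. cmod (z 1) < 1 \<and> \<bar>Re (z 0) - a\<bar> < pi \<and> \<bar>Im (z 0) - b\<bar> < pi}"
      by (auto simp: U window_def torus_dom_def)
    ultimately show ?thesis by auto
  qed
  show inj: "inj_on (torus_cover c) U" using inv by (metis inj_onI)
  have open_slit: "open ((\<lambda>x::cvec. x i * cis r) -` (- \<real>\<^sub>\<le>\<^sub>0))" for i r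
    by (intro open_vimage continuous_intros) (simp add: closed_nonpos_Reals_complex open_Compl)
  have img: "torus_cover c ` U = torus_cover c ` torus_dom m \<inter>
     (((\<lambda>x. x 0 * cis (- a)) -` (- \<real>\<^sub>\<le>\<^sub>0)) \<inter> ((\<lambda>x. x 1 * cis (- b)) -` (- \<real>\<^sub>\<le>\<^sub>0)))"
    unfolding U torus_cover_image_window[OF m] by auto
  show "openin (top_of_set (torus_cover c ` torus_dom m)) (torus_cover c ` U)"
    unfolding img by (intro openin_open_Int open_Int open_slit)
  have "continuous_on (torus_cover c ` U) (window_inverse c a b)"
    unfolding window_inverse_def
    by (rule continuous_on_coordinatewise_then_product)
      (auto intro!: continuous_intros continuous_on_if_const simp: img Complex_eq)
  moreover have "inv_into U (torus_cover c) x = window_inverse c a b x" if "x \<in> torus_cover c ` U" for x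
    using that inj inv by (auto simp: inv_into_f_f)
  ultimately show "continuous_on (torus_cover c ` U) (inv_into U (torus_cover c))"
    by (simp cong: continuous_on_cong)
qed

text \<open>
  This description by equations yields the compactness of the fibres and identifies them inside
  the total space.
\<close>

lemma torus_cover_image:
  assumes m: "m = 1 \<and> R = {0} \<or> m = 2 \<and> R = ball 0 1"
  shows "torus_cover c ` torus_dom m =
    {x. cmod (x 0) = 1 \<and> cmod (x 1) = 1 \<and> x 2 - c \<in> R \<and> (\<forall>i\<ge>3. x i = 0)}" (is "?L = ?R")
proof
  show "?L \<subseteq> ?R" using m by (auto simp: torus_dom_def Csp_def) (auto simp: torus_cover_def)
  show "?R \<subseteq> ?L"
  proof
    fix x :: cvec assume x: "x \<in> ?R"
    define z where "z = window_inverse c 0 0 x"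
    have "z \<in> torus_dom m" using x m by (auto simp: z_def window_inverse_def torus_dom_def Csp_def dist_norm)
    moreover have "torus_cover c z i = x i" for i
    proof -
      consider "i = 0" | "i = 1" | "i = 2" | "i \<ge> 3" by linarith
      then show ?thesis
        using x by cases (auto simp: z_def torus_cover_def window_inverse_def cis_Arg_unit)
    qed
    ultimately show "x \<in> ?L" by (metis ext imageI)
  qed
qed

lemma compact_torus_points:
  assumes "compact K"
  shows "compact {x::cvec. cmod (x 0) = 1 \<and> cmod (x 1) = 1 \<and> x 2 \<in> K \<and> (\<forall>i\<ge>3. x i = 0)}" (is "compact ?S")
proof -
  let ?f = "\<lambda>(u, v, t) i. if i = 0 then u else if i = 1 then v else if i = (2::nat) then t else (0::complex)"
  have "?S = ?f ` (sphere 0 1 \<times> sphere 0 1 \<times> K)" (is "_ = ?R")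
  proof
    show "?S \<subseteq> ?R"
    proof
      fix x assume x: "x \<in> ?S"
      have "?f (x 0, x 1, x 2) i = x i" for i
      proof -
        consider "i = 0" | "i = 1" | "i = 2" | "i \<ge> 3" by linarith
        then show ?thesis using x by cases auto
      qed
      then have "x = ?f (x 0, x 1, x 2)" by auto
      then show "x \<in> ?R" using x by (intro image_eqI[of _ _ "(x 0, x 1, x 2)"]) auto
    qed
  qed auto
  moreover have "continuous_on (sphere 0 1 \<times> sphere 0 1 \<times> K) ?f"
    unfolding case_prod_unfold
    by (rule continuous_on_coordinatewise_then_product) (auto intro!: continuous_intros continuous_on_if_const)
  ultimately show ?thesis
    using assms by (simp only:) (intro compact_continuous_image compact_Times compact_sphere)
qed

section \<open>The base\<close>

definition disc :: "cvec set" where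
  "disc = {z \<in> Csp 1. cmod (z 0) < 1}"

lemma affine_cover_disc: "affine_cover 1 disc (\<lambda>z. z) {disc}"
proof
  show "connected disc"
    by (rule star_connected)
      (auto simp: disc_def Csp_def norm_mult intro: le_less_trans[OF mult_left_le_one_le])
  have "open {z::cvec. cmod (z 0) < 1}" by (intro open_Collect_less continuous_intros)
  then have "openin (top_of_set (Csp 1)) disc"
    unfolding disc_def Collect_conj_eq Collect_mem_eq by (rule openin_open_Int)
  then show "\<And>U. U \<in> {disc} \<Longrightarrow> openin (top_of_set (Csp 1)) U" by auto
  show "lin2 1 w 1 d = w" if "lin2 1 z 1 d = z" for z w d
  proof -
    have "d i = 0" for i using fun_cong[OF that, of i] by simp
    then show ?thesis by (simp add: lin2_def)
  qed
  show "\<And>U. U \<in> {disc} \<Longrightarrow> continuous_on ((\<lambda>z. z) ` U) (inv_into U (\<lambda>z. z))"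
    by (auto intro!: continuous_on_eq[OF continuous_on_id] simp: inv_into_f_f[of "\<lambda>z. z", simplified])
qed (auto simp: disc_def)

section \<open>The potential and its Kaehler form\<close>

definition area :: "complex \<Rightarrow> complex \<Rightarrow> real" where
  "area v w = Im (cnj v * w)"

text \<open>
  The form \<open>6 a\<^sub>z + a\<^sub>t + dd\<^sup>c (2 Re (t exp(i x)))\<close> on the pair \<open>v\<close>, \<open>w\<close>, where \<open>z 0\<close> is the
  coordinate of the torus and \<open>t = c + z 1\<close>.  The constant \<open>6\<close> is a choice in the interval from
  \<open>6\<close> to \<open>8\<close>: it has to be at least \<open>6\<close> for positivity over the unit disc and below \<open>8\<close> for the
  final coefficient \<open>1 - 8 / 6\<close> to be negative.
\<close>

definition omega :: "complex \<Rightarrow> cvec \<Rightarrow> cvec \<Rightarrow> cvec \<Rightarrow> real" where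
  "omega c z v w = (6 - 2 * Re ((c + z 1) * cis (Re (z 0)))) * area (v 0) (w 0) + area (v 1) (w 1)
     + 2 * Re (cis (Re (z 0)) * (cnj (v 0) * w 1 - cnj (w 0) * v 1))"

definition flat :: "real \<Rightarrow> real \<Rightarrow> cvec \<Rightarrow> cvec \<Rightarrow> cvec \<Rightarrow> real" where
  "flat a b z v w = a * area (v 0) (w 0) + b * area (v 1) (w 1)"

text \<open>
  The potential \<open>- |t|\<^sup>2 / 3 - 2 Re (t exp(i x))\<close>, as a function on the points of the product.
\<close>

definition phi :: "cvec \<Rightarrow> real" where
  "phi x = - (cmod (x 2))\<^sup>2 / 3 - 2 * Re (x 2 * x 0)"

text \<open>
  The same function in coordinates, written out in real and imaginary parts for differentiation.
\<close>

definition phi_lift :: "complex \<Rightarrow> cvec \<Rightarrow> real" where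
  "phi_lift c z = - (1/3) * ((Re c + Re (z 1)) * (Re c + Re (z 1)) + (Im c + Im (z 1)) * (Im c + Im (z 1)))
     - 2 * ((Re c + Re (z 1)) * cos (Re (z 0)) - (Im c + Im (z 1)) * sin (Re (z 0)))"

lemma phi_torus_cover: "phi (torus_cover c z) = phi_lift c z"
  unfolding phi_def torus_cover_simps cmod_power2
  by (simp add: phi_lift_def power2_eq_square algebra_simps diff_divide_distrib add_divide_distrib)

lemma trig_poly_phi_lift: "phi_lift c \<in> trig_poly"
  unfolding phi_lift_def[abs_def] by (intro trig_poly.intros trig_poly_diff)

lemma trig_poly_omega: "(\<lambda>z. omega c z v w) \<in> trig_poly"
  unfolding omega_def times_complex.simps cis.simps plus_complex.simps minus_complex.simps
  by (intro trig_poly.intros trig_poly_diff)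

lemma dir_deriv_phi_lift:
  "dir_deriv v (phi_lift c) z =
     - (2/3) * ((Re c + Re (z 1)) * Re (v 1) + (Im c + Im (z 1)) * Im (v 1))
     - 2 * ((Re (v 1) - (Im c + Im (z 1)) * Re (v 0)) * cos (Re (z 0))
            - (Im (v 1) + (Re c + Re (z 1)) * Re (v 0)) * sin (Re (z 0)))"
  unfolding phi_lift_def[abs_def]
  by (rule dir_derivI_real) (auto intro!: derivative_eq_intros simp: algebra_simps)

lemma dir_deriv2_phi_lift:
  "dir_deriv w (dir_deriv v (phi_lift c)) z =
     - (2/3) * (Re (w 1) * Re (v 1) + Im (w 1) * Im (v 1))
     - 2 * (- Im (w 1) * Re (v 0) * cos (Re (z 0))
            - (Re (v 1) - (Im c + Im (z 1)) * Re (v 0)) * sin (Re (z 0)) * Re (w 0)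
            - Re (w 1) * Re (v 0) * sin (Re (z 0))
            - (Im (v 1) + (Re c + Re (z 1)) * Re (v 0)) * cos (Re (z 0)) * Re (w 0))"
  unfolding dir_deriv_phi_lift[abs_def]
  by (rule dir_derivI_real) (auto intro!: derivative_eq_intros simp: algebra_simps)

text \<open>
  Adding \<open>dd\<^sup>c \<phi>\<close> removes the oscillating part of \<open>\<omega>\<close> and turns the coefficient \<open>1\<close> of the base
  into \<open>1 - 4/3\<close>.
\<close>

lemma ddc_phi_lift:
  "dir_deriv w (dir_deriv (Jop v) (phi_lift c)) z - dir_deriv v (dir_deriv (Jop w) (phi_lift c)) z
     = flat 6 (-1/3) z v w - omega c z v w"
  unfolding dir_deriv2_phi_lift flat_def omega_def area_def
  by (simp add: algebra_simps)

lemma dir_deriv_omega: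
  "dir_deriv u (\<lambda>x. omega c x v w) z =
     - 2 * ((Re (u 1) - (Im c + Im (z 1)) * Re (u 0)) * cos (Re (z 0))
            - (Im (u 1) + (Re c + Re (z 1)) * Re (u 0)) * sin (Re (z 0))) * area (v 0) (w 0)
     - 2 * Re (u 0) * (sin (Re (z 0)) * Re (cnj (v 0) * w 1 - cnj (w 0) * v 1)
         + cos (Re (z 0)) * Im (cnj (v 0) * w 1 - cnj (w 0) * v 1))"
  unfolding omega_def[abs_def] times_complex.simps(1) cis.simps plus_complex.simps
  by (rule dir_derivI_real) (auto intro!: derivative_eq_intros simp: algebra_simps)

lemma omega_closed:
  "dir_deriv u (\<lambda>x. omega c x v w) z - dir_deriv v (\<lambda>x. omega c x u w) z
      + dir_deriv w (\<lambda>x. omega c x u v) z = 0"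
  unfolding dir_deriv_omega area_def by (simp add: algebra_simps)

lemma flat_closed:
  "dir_deriv u (\<lambda>x. flat a b x v w) z - dir_deriv v (\<lambda>x. flat a b x u w) z
      + dir_deriv w (\<lambda>x. flat a b x u v) z = 0"
  by (simp add: flat_def)

lemma area_self: "area v (\<i> * v) = (cmod v)\<^sup>2"
  unfolding area_def cmod_power2 by (simp add: power2_eq_square)

text \<open>
  Completing the square reduces positivity of \<open>\<omega>\<close> to \<open>Re (t exp(i x)) < 1\<close>.
\<close>

lemma omega_self:
  "omega c z v (Jop v) = (2 - 2 * Re ((c + z 1) * cis (Re (z 0)))) * (cmod (v 0))\<^sup>2
     + (cmod (v 1 - 2 * \<i> * cnj (cis (Re (z 0))) * v 0))\<^sup>2"
proof -
  define e where "e = cis (Re (z 0))"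
  have e: "(Re e)\<^sup>2 + (Im e)\<^sup>2 = 1" by (simp add: e_def)
  have "(cmod (v 1 - 2 * \<i> * cnj e * v 0))\<^sup>2 =
     (cmod (v 1))\<^sup>2 + 4 * ((Re e)\<^sup>2 + (Im e)\<^sup>2) * (cmod (v 0))\<^sup>2
     + 2 * Re (e * (cnj (v 0) * (\<i> * v 1) - cnj (\<i> * v 0) * v 1))"
    by (simp add: cmod_power2) (simp add: power2_eq_square algebra_simps)
  then show ?thesis
    unfolding omega_def Jop_apply area_self e_def[symmetric] e by (simp add: algebra_simps)
qed

lemma omega_positive:
  assumes "cmod (c + z 1) < 1" "v \<in> Csp 2" "v \<noteq> (\<lambda>_. 0)"
  shows "omega c z v (Jop v) > 0"
proof -
  have "Re ((c + z 1) * cis (Re (z 0))) \<le> cmod ((c + z 1) * cis (Re (z 0)))" by (rule complex_Re_le_cmod)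
  then have R: "2 - 2 * Re ((c + z 1) * cis (Re (z 0))) > 0" using assms by (simp add: norm_mult)
  show ?thesis
  proof (cases "v 0 = 0")
    case True
    have "v 1 \<noteq> 0"
    proof
      assume "v 1 = 0"
      then have "v i = 0" for i
        using assms(2) True by (cases "i \<ge> 2") (auto simp: Csp_def not_le less_2_cases_iff)
      then show False using assms(3) by auto
    qed
    then show ?thesis unfolding omega_self using True by simp
  next
    case False
    then have "(2 - 2 * Re ((c + z 1) * cis (Re (z 0)))) * (cmod (v 0))\<^sup>2 > 0" using R by simp
    then show ?thesis unfolding omega_self by (rule add_pos_nonneg) simp
  qed
qed

abbreviation torus :: "nat \<Rightarrow> complex \<Rightarrow> cvec cmfd" where
  "torus m c \<equiv> affine_cover.mfd m (torus_dom m) (torus_cover c) (windows m)"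

lemma real_1_1_omega:
  assumes "1 \<le> m" "m \<le> 2"
  shows "affine_cover.real_1_1 (torus_dom m) (torus_cover c) (omega c)"
proof -
  interpret affine_cover m "torus_dom m" "torus_cover c" "windows m" by (rule affine_cover_torus[OF assms])
  have "omega c z = omega c z'" if "torus_cover c z = torus_cover c z'" for z z'
  proof -
    have "cis (Re (z 0)) = cis (Re (z' 0))" "z 1 = z' 1"
      using fun_cong[OF that, of 0] fun_cong[OF that, of 2] by auto
    then show ?thesis by (auto simp: omega_def fun_eq_iff)
  qed
  moreover have "omega c z w v = - omega c z v w" for z v w
    by (simp add: omega_def area_def algebra_simps)
  moreover have "omega c z (lin2 a v b w) x = a * omega c z v x + b * omega c z w x" for z a v b w x
    by (simp add: omega_def area_def algebra_simps)
  moreover have "omega c z (Jop v) (Jop w) = omega c z v w" for z v w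
    by (simp add: omega_def area_def algebra_simps)
  ultimately show ?thesis
    unfolding real_1_1_def using trig_poly_omega by blast
qed

lemma (in affine_cover) real_1_1_flat: "real_1_1 (flat a b)"
proof -
  have "flat a b z w v = - flat a b z v w" for z v w
    by (simp add: flat_def area_def algebra_simps)
  moreover have "flat a b z (lin2 r v s w) x = r * flat a b z v x + s * flat a b z w x" for z r v s w x
    by (simp add: flat_def area_def algebra_simps)
  moreover have "flat a b z (Jop v) (Jop w) = flat a b z v w" for z v w
    by (simp add: flat_def area_def algebra_simps)
  moreover have "(\<lambda>z. flat a b z v w) \<in> trig_poly" for v w
    unfolding flat_def by (rule trig_poly.const)
  moreover have "flat a b z = flat a b z'" for z z' by (simp add: flat_def fun_eq_iff)
  ultimately show ?thesis unfolding real_1_1_def by blast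
qed

lemma flat_positive:
  assumes "a > 0" "v \<in> Csp 1" "v \<noteq> (\<lambda>_. 0)"
  shows "flat a b z v (Jop v) > 0"
proof -
  have "v 0 \<noteq> 0"
  proof
    assume "v 0 = 0"
    then have "v i = 0" for i using assms(2) by (cases i) (auto simp: Csp_def)
    then show False using assms(3) by auto
  qed
  moreover have "v 1 = 0" using assms(2) by (simp add: Csp_def)
  ultimately show ?thesis using assms(1) by (simp add: flat_def area_self area_def[of 0])
qed

lemma represents_total:
  assumes m: "1 \<le> m" "m \<le> 2"
    and "affine_cover.represents m (torus_cover c) (windows m) \<alpha> (omega c)"
  shows "affine_cover.represents m (torus_cover c) (windows m) (add_form \<alpha> (ddc (fun_form phi))) (flat 6 (-1/3))"
proof -
  interpret affine_cover m "torus_dom m" "torus_cover c" "windows m" by (rule affine_cover_torus[OF m])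
  show ?thesis
    using represents_add[OF assms(3) represents_ddc[OF trig_poly_phi_lift phi_torus_cover]]
    by (simp add: ddc_phi_lift)
qed

section \<open>Integration over the torus\<close>

lemma lborel_complex_prod:
  "(lborel :: complex measure) = distr (lborel \<Otimes>\<^sub>M lborel) borel (\<lambda>(x, y). Complex x y)"
proof (rule lborel_eqI)
  fix l u :: complex assume le: "\<And>b. b \<in> Basis \<Longrightarrow> l \<bullet> b \<le> u \<bullet> b"
  have le': "Re l \<le> Re u" "Im l \<le> Im u" using le[of 1] le[of \<i>] by (simp_all add: Basis_complex_def)
  have meas: "(\<lambda>(x, y). Complex x y) \<in> (lborel \<Otimes>\<^sub>M lborel) \<rightarrow>\<^sub>M borel"
    unfolding Complex_eq by measurable
  have pre: "(\<lambda>(x, y). Complex x y) -` box l u \<inter> space (lborel \<Otimes>\<^sub>M lborel)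
      = {Re l<..<Re u} \<times> {Im l<..<Im u}"
    by (auto simp: box_def Basis_complex_def space_pair_measure)
  have "emeasure (distr (lborel \<Otimes>\<^sub>M lborel) borel (\<lambda>(x, y). Complex x y)) (box l u)
      = emeasure (lborel \<Otimes>\<^sub>M lborel) ({Re l<..<Re u} \<times> {Im l<..<Im u})"
    by (subst emeasure_distr[OF meas]) (simp, simp only: pre)
  also have "\<dots> = emeasure lborel {Re l<..<Re u} * emeasure lborel {Im l<..<Im u}"
    by (rule lborel.emeasure_pair_measure_Times) auto
  also have "\<dots> = ennreal (\<Prod>b\<in>Basis. (u - l) \<bullet> b)"
    using le' by (simp add: Basis_complex_def ennreal_mult[symmetric])
  finally show "emeasure (distr (lborel \<Otimes>\<^sub>M lborel) borel (\<lambda>(x, y). Complex x y)) (box l u)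
      = ennreal (\<Prod>b\<in>Basis. (u - l) \<bullet> b)" .
qed simp

lemma integral_complex_product:
  fixes f g :: "real \<Rightarrow> real"
  assumes f: "integrable lborel f" and g: "integrable lborel g"
  shows "(LINT w|(lborel :: complex measure). f (Re w) * g (Im w)) = (LINT x|lborel. f x) * (LINT y|lborel. g y)"
proof -
  have [measurable]: "f \<in> borel_measurable borel" "g \<in> borel_measurable borel"
    using f g by auto
  have int: "integrable (lborel \<Otimes>\<^sub>M lborel) (\<lambda>(x, y). f x * g y)"
  proof (rule lborel_pair.Fubini_integrable)
    show "(\<lambda>(x, y). f x * g y) \<in> borel_measurable (lborel \<Otimes>\<^sub>M lborel)" by measurable
    show "integrable lborel (\<lambda>x. LINT y|lborel. norm (case (x, y) of (x, y) \<Rightarrow> f x * g y))"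
      using f by (simp add: abs_mult)
    show "AE x in lborel. integrable lborel (\<lambda>y. case (x, y) of (x, y) \<Rightarrow> f x * g y)"
      using g by simp
  qed
  have meas: "(\<lambda>(x, y). Complex x y) \<in> (lborel \<Otimes>\<^sub>M lborel) \<rightarrow>\<^sub>M borel"
    unfolding Complex_eq by measurable
  have "(LINT w|(lborel :: complex measure). f (Re w) * g (Im w)) = (LINT p|(lborel \<Otimes>\<^sub>M lborel). f (fst p) * g (snd p))"
    by (subst lborel_complex_prod, subst integral_distr[OF meas]) (simp_all add: case_prod_unfold)
  also have "\<dots> = (LINT x|lborel. LINT y|lborel. f x * g y)"
    using lborel_pair.integral_fst'[OF int] by (simp add: case_prod_unfold)
  also have "\<dots> = (LINT x|lborel. f x) * (LINT y|lborel. g y)" by simp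
  finally show ?thesis .
qed

lemma lebesgue_Csp_product:
  fixes f g :: "real \<Rightarrow> real"
  assumes f: "integrable lborel f" and g: "integrable lborel g"
    and F: "\<And>z. z \<in> Csp 1 \<Longrightarrow> F z = f (Re (z 0)) * g (Im (z 0))"
  shows "lebesgue_Csp 1 F = (LINT x|lborel. f x) * (LINT y|lborel. g y)"
proof -
  interpret product_sigma_finite "\<lambda>_::nat. lborel :: complex measure" by unfold_locales
  have [measurable]: "f \<in> borel_measurable borel" "g \<in> borel_measurable borel"
    using f g by auto
  have "lebesgue_Csp 1 F = (LINT x|(\<Pi>\<^sub>M i\<in>{0::nat}. (lborel :: complex measure)). f (Re (x 0)) * g (Im (x 0)))"
    unfolding lebesgue_Csp_def using F by (simp add: lessThan_Suc Csp_def)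
  also have "\<dots> = (LINT w|(lborel :: complex measure). f (Re w) * g (Im w))"
    by (rule product_integral_singleton) measurable
  finally show ?thesis using integral_complex_product[OF f g] by simp
qed

lemma window_integral:
  fixes f :: "real \<Rightarrow> real"
  assumes "continuous_on UNIV f"
  shows "integrable lborel (\<lambda>x. if \<bar>x - a\<bar> < pi then f x else 0)"
    and "(LINT x|lborel. (if \<bar>x - a\<bar> < pi then f x else 0)) = integral {a - pi..a + pi} f"
proof -
  have eq: "(\<lambda>x. if \<bar>x - a\<bar> < pi then f x else 0) = (\<lambda>x. indicator {a - pi<..<a + pi} x *\<^sub>R f x)"
    by (auto simp: fun_eq_iff indicator_def)
  have "set_integrable lborel {a - pi..a + pi} f"
    by (rule borel_integrable_atLeastAtMost') (rule continuous_on_subset[OF assms], simp)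
  then have si: "set_integrable lborel {a - pi<..<a + pi} f"
    by (rule set_integrable_subset) auto
  then show "integrable lborel (\<lambda>x. if \<bar>x - a\<bar> < pi then f x else 0)"
    unfolding eq set_integrable_def .
  show "(LINT x|lborel. (if \<bar>x - a\<bar> < pi then f x else 0)) = integral {a - pi..a + pi} f"
    using set_borel_integral_eq_integral(2)[OF si]
    unfolding eq set_lebesgue_integral_def integral_open_interval_real[of "a - pi"] .
qed

text \<open>
  The windows centred at \<open>0\<close> and at \<open>pi\<close> are different intervals; by periodicity both integrals may
  be taken over the same one.
\<close>

lemma periodic_integral_shift:
  fixes f :: "real \<Rightarrow> real"
  assumes cont: "continuous_on UNIV f" and per: "\<And>x. f (x + 2 * pi) = f x"
  shows "integral {pi - pi..pi + pi} f = integral {0 - pi..0 + pi} f"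
proof -
  have int: "f integrable_on {a..b}" for a b
    by (rule integrable_continuous_real) (rule continuous_on_subset[OF cont], simp)
  have "f (2 * pi + x) = f x" for x using per[of x] by (simp only: add.commute)
  then have "(\<lambda>x. f (2 * pi + x)) = f" by blast
  then have "(f has_integral integral {-pi..0} f) {-pi + 2 * pi..0 + 2 * pi}"
    using has_integral_shift_Icc_real[of f "2 * pi" "integral {-pi..0} f" "-pi" 0] int[of "-pi" 0]
    by (simp add: comp_def has_integral_integral)
  then have "integral {-pi + 2 * pi..0 + 2 * pi} f = integral {-pi..0} f"
    by (rule integral_unique)
  then have "integral {pi..2 * pi} f = integral {-pi..0} f" by simp
  moreover have "integral {0..pi} f + integral {pi..2 * pi} f = integral {0..2 * pi} f"
    by (rule Henstock_Kurzweil_Integration.integral_combine) (auto intro: int)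
  moreover have "integral {-pi..0} f + integral {0..pi} f = integral {-pi..pi} f"
    by (rule Henstock_Kurzweil_Integration.integral_combine) (auto intro: int)
  ultimately show ?thesis by simp
qed

text \<open>
  A continuous cut-off on the circle, centred at \<open>exp(i a)\<close>.  Opposite centres give complementary
  functions, and the support avoids the slit at the antipode.
\<close>

definition bump :: "real \<Rightarrow> complex \<Rightarrow> real" where
  "bump a u = min 1 (max 0 (1/2 + Re (u * cis (- a))))"

lemma bump_sum: "bump 0 u + bump pi u = 1"
proof -
  have "cis (- pi) = -1" by (simp add: complex_eq_iff)
  then show ?thesis by (simp add: bump_def min_def max_def)
qed

lemma bump_nonneg: "0 \<le> bump a u"
  by (simp add: bump_def)

lemma bump_continuous: "continuous_on S f \<Longrightarrow> continuous_on S (\<lambda>x. bump a (f x))"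
  unfolding bump_def by (intro continuous_intros)

lemma bump_nonzero: "bump a u \<noteq> 0 \<Longrightarrow> Re (u * cis (- a)) \<ge> -1/2"
  by (auto simp: bump_def min_def max_def split: if_splits)

lemma slit_of_Re: "cmod u = 1 \<Longrightarrow> Re (u * cis (- a)) \<ge> -1/2 \<Longrightarrow> u * cis (- a) \<notin> \<real>\<^sub>\<le>\<^sub>0"
proof
  assume u: "cmod u = 1" and R: "Re (u * cis (- a)) \<ge> -1/2" and m: "u * cis (- a) \<in> \<real>\<^sub>\<le>\<^sub>0"
  define w where "w = u * cis (- a)"
  have *: "Re w \<le> 0" "Im w = 0" using m by (auto simp: complex_nonpos_Reals_iff w_def)
  have "cmod w = 1" using u by (simp add: norm_mult w_def)
  then have "(Re w)\<^sup>2 = 1" using *(2) cmod_power2[of w] by simp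
  then show False using R *(1) unfolding w_def[symmetric] power2_eq_1_iff by linarith
qed

definition four_centres :: "(real \<times> real) set" where
  "four_centres = {0, pi} \<times> {0, pi}"

abbreviation window_chart :: "complex \<Rightarrow> real \<times> real \<Rightarrow> cvec chart" where
  "window_chart c q \<equiv> cover_chart (torus_cover c) (window 1 (fst q) (snd q))"

lemma inj_window_chart: "inj_on (window_chart c) four_centres"
proof (rule inj_onI)
  interpret affine_cover 1 "torus_dom 1" "torus_cover c" "windows 1" by (rule affine_cover_torus) auto
  fix q r assume q: "q \<in> four_centres" and r: "r \<in> four_centres" and eq: "window_chart c q = window_chart c r"
  have "window 1 (fst q) (snd q) \<in> windows 1" for q by (auto simp: windows_def)
  then have eq: "window 1 (fst q) (snd q) = window 1 (fst r) (snd r)"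
    using chart_image_U eq by metis
  define z :: cvec where "z = (\<lambda>i. if i = 0 then Complex (fst q) (snd q) else 0)"
  have "z \<in> window 1 (fst q) (snd q)" by (simp add: z_def window_def torus_dom_def Csp_def)
  then have "z \<in> window 1 (fst r) (snd r)" using eq by simp
  then have "\<bar>fst q - fst r\<bar> < pi" "\<bar>snd q - snd r\<bar> < pi" by (auto simp: z_def window_def)
  then show "q = r" using q r by (auto simp: four_centres_def)
qed

text \<open>
  Four squares centred at the half periods carry a product partition of unity.  In every chart the
  integrand is a product, and adding up the factors in one variable removes the partition.
\<close>

lemma torus_integral_zero:
  fixes g :: "real \<Rightarrow> real"
  assumes \<eta>: "\<And>U z. U \<in> windows 1 \<Longrightarrow> z \<in> U \<Longrightarrow>
      \<eta> (cover_chart (torus_cover c) U) z (std_frame 1) = g (Re (z 0))"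
    and cont: "continuous_on UNIV g" and per: "\<And>x. g (x + 2 * pi) = g x"
    and zero: "(g has_integral 0) {-pi..pi}"
  shows "form_has_integral (torus 1 c) \<eta> 0"
proof -
  interpret affine_cover 1 "torus_dom 1" "torus_cover c" "windows 1" by (rule affine_cover_torus) auto
  let ?M = "torus_cover c ` torus_dom 1"
  have M: "?M = {x. cmod (x 0) = 1 \<and> cmod (x 1) = 1 \<and> x 2 \<in> {c} \<and> (\<forall>i\<ge>3. x i = 0)}"
    by (subst torus_cover_image[of _ "{0}"]) auto
  have compact: "compact ?M" unfolding M by (rule compact_torus_points) simp
  define \<kappa> where "\<kappa> q x = bump (fst q) (x 0) * bump (snd q) (x 1)" for q and x :: cvec
  \<comment> \<open>The partition is indexed by charts, so each chart has to remember its centre.\<close>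
  define \<rho> where "\<rho> C = \<kappa> (inv_into four_centres (window_chart c) C)" for C
  have \<rho>: "\<rho> (window_chart c q) = \<kappa> q" if "q \<in> four_centres" for q
    unfolding \<rho>_def by (simp only: inv_into_f_f[OF inj_window_chart that])
  have window: "window 1 a b \<in> windows 1" for a b by (auto simp: windows_def)
  define f where "f a = (\<lambda>s. bump a (cis s) * g s)" for a
  have fcont: "continuous_on UNIV (f a)" for a
    unfolding f_def by (intro continuous_intros bump_continuous cont)
  have bcont: "continuous_on UNIV (\<lambda>s. bump b (cis s))" for b
    by (intro continuous_intros bump_continuous)
  define I where "I a = (LINT s|lborel. (if \<bar>s - a\<bar> < pi then f a s else 0))" for a
  define J where "J b = (LINT s|lborel. (if \<bar>s - b\<bar> < pi then bump b (cis s) else 0))" for b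
  have chart: "lebesgue_Csp 1 (\<lambda>z. if z \<in> chart_image (window_chart c q)
      then \<rho> (window_chart c q) (chart_inv (window_chart c q) z) * \<eta> (window_chart c q) z (std_frame 1) else 0)
      = I (fst q) * J (snd q)" if q: "q \<in> four_centres" for q
    unfolding I_def J_def
  proof (rule lebesgue_Csp_product[OF window_integral(1)[OF fcont] window_integral(1)[OF bcont]])
    fix z :: cvec assume z: "z \<in> Csp 1"
    have z1: "z 1 = 0" using z by (simp add: Csp_def)
    have mem: "z \<in> window 1 (fst q) (snd q) \<longleftrightarrow> \<bar>Re (z 0) - fst q\<bar> < pi \<and> \<bar>Im (z 0) - snd q\<bar> < pi"
      using z z1 by (simp add: window_def torus_dom_def)
    show "(if z \<in> chart_image (window_chart c q)
      then \<rho> (window_chart c q) (chart_inv (window_chart c q) z) * \<eta> (window_chart c q) z (std_frame 1) else 0) =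
      (if \<bar>Re (z 0) - fst q\<bar> < pi then f (fst q) (Re (z 0)) else 0) *
      (if \<bar>Im (z 0) - snd q\<bar> < pi then bump (snd q) (cis (Im (z 0))) else 0)"
    proof (cases "z \<in> window 1 (fst q) (snd q)")
      case True
      then show ?thesis
        using mem unfolding chart_image_U[OF window] chart_inv_U[OF window True] \<eta>[OF window True] \<rho>[OF q]
        by (simp add: \<kappa>_def f_def)
    next
      case False
      then show ?thesis using mem unfolding chart_image_U[OF window] by auto
    qed
  qed
  \<comment> \<open>The sum over the charts factors; its first factor is the integral of \<open>g\<close> over a period.\<close>
  have "I 0 + I pi = 0"
  proof -
    have per': "f a (x + 2 * pi) = f a x" for a x
      by (simp add: f_def per cis_mult[symmetric])
    have int: "f a integrable_on {-pi..pi}" for a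
      by (rule integrable_continuous_real) (rule continuous_on_subset[OF fcont], simp)
    have "I 0 + I pi = integral {-pi..pi} (f 0) + integral {-pi..pi} (f pi)"
      unfolding I_def window_integral(2)[OF fcont] periodic_integral_shift[OF fcont per'] by simp
    also have "\<dots> = integral {-pi..pi} (\<lambda>s. f 0 s + f pi s)"
      by (rule integral_add[symmetric]) (rule int)+
    also have "(\<lambda>s. f 0 s + f pi s) = g"
      using bump_sum by (simp add: f_def fun_eq_iff distrib_right[symmetric])
    finally show ?thesis using zero by (simp add: integral_unique)
  qed
  then have "0 = (I 0 + I pi) * (J 0 + J pi)" by simp
  also have "\<dots> = (\<Sum>q\<in>four_centres. I (fst q) * J (snd q))"
    by (simp add: four_centres_def sum.cartesian_product' case_prod_unfold algebra_simps)
  also have "\<dots> = (\<Sum>C\<in>window_chart c ` four_centres. lebesgue_Csp 1 (\<lambda>z. if z \<in> chart_image C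
      then \<rho> C (chart_inv C z) * \<eta> C z (std_frame 1) else 0))"
    unfolding sum.reindex[OF inj_window_chart] comp_def
    by (rule sum.cong[OF refl]) (rule chart[symmetric])
  finally have total: "0 = (\<Sum>C\<in>window_chart c ` four_centres. lebesgue_Csp 1 (\<lambda>z. if z \<in> chart_image C
      then \<rho> C (chart_inv C z) * \<eta> C z (std_frame 1) else 0))" .
  have cont\<kappa>: "continuous_on ?M (\<kappa> q)" for q
    unfolding \<kappa>_def by (intro continuous_intros bump_continuous)
  have supp: "top_of_set ?M closure_of {x \<in> ?M. \<kappa> q x \<noteq> 0} \<subseteq> torus_cover c ` window 1 (fst q) (snd q)" for q
  proof -
    let ?S = "{x::cvec. -1/2 \<le> Re (x 0 * cis (- fst q)) \<and> -1/2 \<le> Re (x 1 * cis (- snd q))}"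
    have "closed ?S"
      by (intro closed_Collect_conj closed_Collect_le continuous_intros)
    then have "closedin (top_of_set ?M) (?M \<inter> ?S)" by (rule closedin_closed_Int)
    moreover have "{x \<in> ?M. \<kappa> q x \<noteq> 0} \<subseteq> ?M \<inter> ?S"
      using bump_nonzero by (auto simp: \<kappa>_def)
    ultimately have "top_of_set ?M closure_of {x \<in> ?M. \<kappa> q x \<noteq> 0} \<subseteq> ?M \<inter> ?S"
      by (rule closure_of_minimal[rotated])
    also have "\<dots> \<subseteq> torus_cover c ` window 1 (fst q) (snd q)"
      unfolding torus_cover_image_window[OF le_refl one_le_numeral]
      using slit_of_Re by (auto simp: M)
    finally show ?thesis .
  qed
  have unity: "(\<Sum>C\<in>window_chart c ` four_centres. \<rho> C x) = 1" for x
  proof -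
    have "(\<Sum>C\<in>window_chart c ` four_centres. \<rho> C x) = (\<Sum>q\<in>four_centres. \<kappa> q x)"
      unfolding sum.reindex[OF inj_window_chart] comp_def by (rule sum.cong[OF refl]) (simp only: \<rho>)
    also have "\<dots> = (bump 0 (x 0) + bump pi (x 0)) * (bump 0 (x 1) + bump pi (x 1))"
      by (simp add: four_centres_def \<kappa>_def sum.cartesian_product' case_prod_unfold algebra_simps)
    finally show ?thesis by (simp add: bump_sum)
  qed
  show ?thesis
    unfolding form_has_integral_def mfd_simps
  proof (intro conjI exI[of _ "window_chart c ` four_centres"] exI[of _ \<rho>])
    show "compact_space (top_of_set ?M)" using compact by (simp add: compact_space_subtopology)
    show "finite (window_chart c ` four_centres)" by (simp add: four_centres_def)
    show "window_chart c ` four_centres \<subseteq> cover_chart (torus_cover c) ` windows 1" using window by auto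
    show "\<forall>C\<in>window_chart c ` four_centres. continuous_map (top_of_set ?M) euclideanreal (\<rho> C) \<and>
       (\<forall>x\<in>topspace (top_of_set ?M). 0 \<le> \<rho> C x) \<and>
       top_of_set ?M closure_of {x \<in> topspace (top_of_set ?M). \<rho> C x \<noteq> 0} \<subseteq> fst C"
    proof (intro ballI conjI)
      fix C assume "C \<in> window_chart c ` four_centres"
      then obtain q where q: "q \<in> four_centres" and C: "C = window_chart c q" by auto
      show "continuous_map (top_of_set ?M) euclideanreal (\<rho> C)"
        unfolding C \<rho>[OF q] using cont\<kappa> by simp
      show "0 \<le> \<rho> C x" for x
        unfolding C \<rho>[OF q] by (simp add: \<kappa>_def bump_nonneg)
      show "top_of_set ?M closure_of {x \<in> topspace (top_of_set ?M). \<rho> C x \<noteq> 0} \<subseteq> fst C"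
        unfolding C \<rho>[OF q] using supp[of q] by (simp add: cover_chart_def)
    qed
    show "\<forall>x\<in>topspace (top_of_set ?M). (\<Sum>C\<in>window_chart c ` four_centres. \<rho> C x) = 1"
      using unity by auto
  qed (rule total)
qed

text \<open>
  With \<open>S\<close> the imaginary part of \<open>c exp(i s)\<close> one has \<open>R' = - S\<close>, \<open>S' = R\<close> and \<open>R\<^sup>2 + S\<^sup>2 = |c|\<^sup>2\<close>, so
  \<open>2 (R S)' = 4 R\<^sup>2 - 2 |c|\<^sup>2\<close>.  The constant term of the integrand cancels exactly \<open>- 2 |c|\<^sup>2\<close>, which
  leaves a periodic antiderivative.
\<close>

lemma integral_potential_zero:
  fixes c :: complex
  defines "R \<equiv> \<lambda>s. Re (c * cis s)"
  shows "((\<lambda>s. (- (cmod c)\<^sup>2 / 3 - 2 * R s) * (6 - 2 * R s)) has_integral 0) {-pi..pi}"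
proof -
  define S where "S s = Im (c * cis s)" for s
  define G where "G s = (2/3 * (cmod c)\<^sup>2 - 12) * S s + 2 * R s * S s" for s
  have RS: "(cmod c)\<^sup>2 = (R s)\<^sup>2 + (S s)\<^sup>2" for s
    using cmod_power2[of "c * cis s"] by (simp add: R_def S_def norm_mult)
  have dR: "(R has_real_derivative - S s) (at s)" and dS: "(S has_real_derivative R s) (at s)" for s
    unfolding R_def S_def by (auto intro!: derivative_eq_intros simp: algebra_simps)
  have "(G has_real_derivative (- (cmod c)\<^sup>2 / 3 - 2 * R s) * (6 - 2 * R s)) (at s)" for s
  proof -
    have "(G has_real_derivative (2/3 * (cmod c)\<^sup>2 - 12) * R s + 2 * (R s * R s - S s * S s)) (at s)"
      unfolding G_def by (auto intro!: derivative_eq_intros dR dS simp: algebra_simps)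
    moreover have "(2/3 * (cmod c)\<^sup>2 - 12) * R s + 2 * (R s * R s - S s * S s) =
        (- (cmod c)\<^sup>2 / 3 - 2 * R s) * (6 - 2 * R s)"
    proof -
      have "S s * S s = (cmod c)\<^sup>2 - R s * R s" using RS[of s] by (simp add: power2_eq_square)
      then show ?thesis by (simp add: algebra_simps)
    qed
    ultimately show ?thesis by simp
  qed
  then have "((\<lambda>s. (- (cmod c)\<^sup>2 / 3 - 2 * R s) * (6 - 2 * R s)) has_integral (G pi - G (-pi))) {-pi..pi}"
    by (intro fundamental_theorem_of_calculus)
      (auto simp: has_real_derivative_iff_has_vector_derivative[symmetric] intro: has_field_derivative_at_within)
  moreover have "G pi = G (- pi)" by (simp add: G_def R_def S_def)
  ultimately show ?thesis by simp
qed

section \<open>The product of a torus and the disc\<close>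

definition base_proj :: "cvec \<Rightarrow> cvec" where
  "base_proj x = (\<lambda>i. if i = 0 then x 2 else 0)"

abbreviation disc_mfd :: "cvec cmfd" where
  "disc_mfd \<equiv> affine_cover.mfd 1 disc (\<lambda>z. z) {disc}"

abbreviation omega_form :: "cvec form" where
  "omega_form \<equiv> \<lambda>C z vs. omega 0 z (vs ! 0) (vs ! 1)"

lemma affine_cover_map_proj:
  "affine_cover_map 2 (torus_dom 2) (torus_cover 0) (windows 2) 1 disc (\<lambda>z. z) {disc}
     (\<lambda>v i. if i = 0 then v 1 else 0) base_proj (\<lambda>_. 0)"
proof (intro affine_cover_map.intro affine_cover_torus affine_cover_disc)
  show "complex_linear_map (\<lambda>v i. if i = 0 then v 1 else 0)"
    by unfold_locales (auto simp: fun_eq_iff intro!: continuous_intros continuous_on_if_const)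
  show "affine_cover_map_axioms 2 (torus_dom 2) (torus_cover 0) 1 disc (\<lambda>z. z)
     (\<lambda>v i. if i = 0 then v 1 else 0) base_proj (\<lambda>_. 0)"
    by unfold_locales (auto simp: Csp_def disc_def torus_dom_def base_proj_def fun_eq_iff)
qed auto

lemma affine_cover_map_incl:
  assumes "y \<in> disc"
  shows "affine_cover_map 1 (torus_dom 1) (torus_cover (y 0)) (windows 1)
     2 (torus_dom 2) (torus_cover 0) (windows 2) (\<lambda>v. v) (\<lambda>x. x) (\<lambda>i. if i = 1 then y 0 else 0)"
proof (intro affine_cover_map.intro affine_cover_torus complex_linear_map_id)
  show "affine_cover_map_axioms 1 (torus_dom 1) (torus_cover (y 0)) 2 (torus_dom 2) (torus_cover 0)
     (\<lambda>v. v) (\<lambda>x. x) (\<lambda>i. if i = 1 then y 0 else 0)"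
    using assms by unfold_locales (auto simp: Csp_def disc_def torus_dom_def torus_cover_def fun_eq_iff)
qed auto

text \<open>
  The preimage of a compact set \<open>K\<close> is the product of \<open>K\<close> with two circles.
\<close>

lemma proper_base_proj:
  "proper_map (top_of_set (torus_cover 0 ` torus_dom 2)) (top_of_set disc) base_proj"
proof -
  let ?M = "torus_cover 0 ` torus_dom 2"
  have M: "?M = {x. cmod (x 0) = 1 \<and> cmod (x 1) = 1 \<and> x 2 - 0 \<in> ball 0 1 \<and> (\<forall>i\<ge>3. x i = 0)}"
    by (rule torus_cover_image) simp
  have cont: "continuous_on ?M base_proj"
    unfolding base_proj_def
    by (rule continuous_on_coordinatewise_then_product)
      (auto intro!: continuous_intros continuous_on_if_const)
  have sub: "base_proj ` ?M \<subseteq> disc"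
    unfolding M by (auto simp: base_proj_def disc_def Csp_def)
  show ?thesis
  proof (rule compact_imp_proper_map)
    show "k_space (top_of_set disc)"
      by (rule metrizable_imp_k_space) (simp add: metrizable_space_euclidean metrizable_space_subtopology)
    show "kc_space (top_of_set disc)"
      by (simp add: kc_space_euclidean kc_space_subtopology)
    show "base_proj \<in> topspace (top_of_set ?M) \<rightarrow> topspace (top_of_set disc)" using sub by auto
    show "continuous_map (top_of_set ?M) (top_of_set disc) base_proj \<or> kc_space (top_of_set ?M)"
      using cont sub by auto
    fix K assume "compactin (top_of_set disc) K"
    then have K: "compact K" "K \<subseteq> disc" by (auto simp: compactin_subtopology)
    have "compact ((\<lambda>y. y 0) ` K)"
      by (intro compact_continuous_image K continuous_intros)
    then have "compact {x::cvec. cmod (x 0) = 1 \<and> cmod (x 1) = 1 \<and> x 2 \<in> (\<lambda>y. y 0) ` K \<and> (\<forall>i\<ge>3. x i = 0)}"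
      by (rule compact_torus_points)
    also have "{x::cvec. cmod (x 0) = 1 \<and> cmod (x 1) = 1 \<and> x 2 \<in> (\<lambda>y. y 0) ` K \<and> (\<forall>i\<ge>3. x i = 0)}
       = {x \<in> ?M. base_proj x \<in> K}" (is "?L = ?R")
    proof
      show "?L \<subseteq> ?R"
      proof
        fix x assume x: "x \<in> ?L"
        then obtain y where y: "y \<in> K" "x 2 = y 0" by auto
        then have "y \<in> disc" using K by auto
        then have "base_proj x = y" "cmod (x 2) < 1"
          using y by (auto simp: base_proj_def disc_def Csp_def fun_eq_iff)
        then show "x \<in> ?R" unfolding M using x y by auto
      qed
      show "?R \<subseteq> ?L" unfolding M by (auto simp: base_proj_def image_iff intro!: bexI[of _ "base_proj x" for x])
    qed
    finally show "compactin (top_of_set ?M) {x \<in> topspace (top_of_set ?M). base_proj x \<in> K}"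
      by (auto simp: compactin_subtopology)
  qed
qed

lemma fibre_points:
  assumes y: "y \<in> disc"
  shows "torus_cover (y 0) ` torus_dom 1 = {x \<in> torus_cover 0 ` torus_dom 2. base_proj x = y}"
proof -
  have X: "torus_cover 0 ` torus_dom 2 = {x. cmod (x 0) = 1 \<and> cmod (x 1) = 1 \<and> x 2 - 0 \<in> ball 0 1 \<and> (\<forall>i\<ge>3. x i = 0)}"
    by (rule torus_cover_image) simp
  have F: "torus_cover (y 0) ` torus_dom 1 = {x. cmod (x 0) = 1 \<and> cmod (x 1) = 1 \<and> x 2 - y 0 \<in> {0} \<and> (\<forall>i\<ge>3. x i = 0)}"
    by (rule torus_cover_image) simp
  have "base_proj x = y \<longleftrightarrow> x 2 = y 0" for x
    using y by (auto simp: base_proj_def disc_def Csp_def fun_eq_iff)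
  then show ?thesis unfolding X F using y by (auto simp: disc_def)
qed

lemma fibration_example:
  "smooth_proper_fibration (torus 2 0) disc_mfd base_proj (\<lambda>y. torus 1 (y 0))"
proof -
  interpret pr: affine_cover_map 2 "torus_dom 2" "torus_cover 0" "windows 2" 1 disc "\<lambda>z. z" "{disc}"
    "\<lambda>v i. if i = 0 then v 1 else 0" base_proj "\<lambda>_. 0"
    by (rule affine_cover_map_proj)
  have onto: "base_proj ` torus_cover 0 ` torus_dom 2 = disc"
  proof
    show "disc \<subseteq> base_proj ` torus_cover 0 ` torus_dom 2"
    proof
      fix y assume y: "y \<in> disc"
      have "(\<lambda>_. 0) \<in> torus_dom 1" by (simp add: torus_dom_def Csp_def)
      then have "torus_cover (y 0) (\<lambda>_. 0) \<in> {x \<in> torus_cover 0 ` torus_dom 2. base_proj x = y}"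
        unfolding fibre_points[OF y, symmetric] by (rule imageI)
      then show "y \<in> base_proj ` torus_cover 0 ` torus_dom 2"
        by (intro image_eqI[of y base_proj "torus_cover (y 0) (\<lambda>_. 0)"]) simp_all
    qed
  qed (use pr.f_maps in auto)
  have subm: "(\<lambda>v i. if i = 0 then v 1 else 0) ` Csp 2 = Csp 1" (is "?L ` _ = _")
  proof
    show "Csp 1 \<subseteq> ?L ` Csp 2"
    proof
      fix w :: cvec assume w: "w \<in> Csp 1"
      have "w = ?L (\<lambda>i. if i = 1 then w 0 else 0)" using w by (auto simp: Csp_def fun_eq_iff)
      moreover have "(\<lambda>i. if i = 1 then w 0 else 0) \<in> Csp 2" by (auto simp: Csp_def)
      ultimately show "w \<in> ?L ` Csp 2" by (rule image_eqI)
    qed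
  qed (auto simp: Csp_def)
  have fib: "complex_submanifold (torus 1 (y 0)) (torus 2 0) \<and> mdim (torus 1 (y 0)) = mdim (torus 2 0) - mdim disc_mfd \<and>
        topspace (mtop (torus 1 (y 0))) = {x \<in> topspace (mtop (torus 2 0)). base_proj x = y}"
    if y: "y \<in> disc" for y
  proof -
    interpret inc: affine_cover_map 1 "torus_dom 1" "torus_cover (y 0)" "windows 1"
      2 "torus_dom 2" "torus_cover 0" "windows 2" "\<lambda>v. v" "\<lambda>x. x" "\<lambda>i. if i = 1 then y 0 else 0"
      by (rule affine_cover_map_incl[OF y])
    have sub: "torus_cover (y 0) ` torus_dom 1 \<subseteq> torus_cover 0 ` torus_dom 2"
      using inc.f_maps by simp
    have "complex_submanifold (torus 1 (y 0)) (torus 2 0)"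
      unfolding complex_submanifold_def inc.src.mfd_simps pr.src.mfd_simps
      using inc.src.complex_manifold_mfd inc.holomorphic_map_f inc.immersion_f sub
      by (simp add: subtopology_subtopology Int_absorb1)
    then show ?thesis
      unfolding inc.src.mfd_simps pr.src.mfd_simps pr.tgt.mfd_simps
      using fibre_points[OF y] by simp
  qed
  show ?thesis
    unfolding smooth_proper_fibration_def
  proof (intro conjI ballI)
    show "complex_manifold (torus 2 0)" by (rule pr.src.complex_manifold_mfd)
    show "complex_manifold disc_mfd" by (rule pr.tgt.complex_manifold_mfd)
    show "holomorphic_map (torus 2 0) disc_mfd base_proj" by (rule pr.holomorphic_map_f)
    show "base_proj ` topspace (mtop (torus 2 0)) = topspace (mtop disc_mfd)"
      unfolding pr.src.mfd_simps pr.tgt.mfd_simps using onto by simp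
    show "submersion (torus 2 0) disc_mfd base_proj" by (rule pr.submersion_f[OF subm])
    show "proper_map (mtop (torus 2 0)) (mtop disc_mfd) base_proj"
      unfolding pr.src.mfd_simps pr.tgt.mfd_simps using proper_base_proj by simp
    fix y assume "y \<in> topspace (mtop disc_mfd)"
    then have "y \<in> disc" unfolding pr.tgt.mfd_simps by simp
    then show "complex_submanifold (torus 1 (y 0)) (torus 2 0)"
      "mdim (torus 1 (y 0)) = mdim (torus 2 0) - mdim disc_mfd"
      "topspace (mtop (torus 1 (y 0))) = {x \<in> topspace (mtop (torus 2 0)). base_proj x = y}"
      using fib by blast+
  qed
qed

lemma kahler_omega: "kahler_form (torus 2 0) omega_form"
proof -
  interpret affine_cover 2 "torus_dom 2" "torus_cover 0" "windows 2" by (rule affine_cover_torus) auto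
  have "represents omega_form (omega 0)" by (simp add: represents_def)
  then show ?thesis
    by (rule kahler_form_represents[OF _ real_1_1_omega])
      (auto simp: torus_dom_def omega_closed intro!: omega_positive)
qed

lemma kahler_disc: "kahler_manifold disc_mfd"
proof -
  interpret affine_cover 1 disc "\<lambda>z. z" "{disc}" by (rule affine_cover_disc)
  have "represents (\<lambda>C z vs. flat 1 0 z (vs ! 0) (vs ! 1)) (flat 1 0)" unfolding represents_def by simp
  then have "kahler_form mfd (\<lambda>C z vs. flat 1 0 z (vs ! 0) (vs ! 1))"
    by (rule kahler_form_represents[OF _ real_1_1_flat]) (auto intro!: flat_positive flat_closed)
  then show ?thesis unfolding kahler_manifold_def using complex_manifold_mfd by blast
qed

text \<open>
  The inclusion of the fibre over \<open>y\<close> lifts to a translation, so restricting \<open>\<omega>\<close> only moves the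
  parameter \<open>c\<close> of \<open>omega\<close> to \<open>y\<close>.
\<close>

lemma represents_restrict:
  assumes "y \<in> disc"
  shows "affine_cover.represents 1 (torus_cover (y 0)) (windows 1) (restrict_form (torus 2 0) omega_form) (omega (y 0))"
proof -
  interpret inc: affine_cover_map 1 "torus_dom 1" "torus_cover (y 0)" "windows 1"
    2 "torus_dom 2" "torus_cover 0" "windows 2" "\<lambda>v. v" "\<lambda>x. x" "\<lambda>i. if i = 1 then y 0 else 0"
    by (rule affine_cover_map_incl[OF assms])
  have "inc.tgt.represents omega_form (omega 0)" by (simp add: inc.tgt.represents_def)
  moreover have "inc.tgt.real_1_1 (omega 0)" by (rule real_1_1_omega) auto
  ultimately have "inc.src.represents (pullback inc.tgt.mfd (\<lambda>x. x) omega_form) (\<lambda>z v w. omega 0 (inc.lft z) v w)"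
    by (rule inc.represents_pullback)
  moreover have "omega 0 (inc.lft z) v w = omega (y 0) z v w" for z v w
    by (simp add: omega_def)
  ultimately show ?thesis unfolding restrict_form_def by simp
qed

lemma flat_frame: "flat a b z (cunit 0) (Jop (cunit 0)) = a"
  by (simp add: flat_def cunit_def area_def)

lemma c1_zero_torus: "c1_zero (torus 1 c)"
proof -
  interpret affine_cover 1 "torus_dom 1" "torus_cover c" "windows 1" by (rule affine_cover_torus) auto
  have "represents (\<lambda>C z vs. flat 1 0 z (vs ! 0) (vs ! 1)) (flat 1 0)" unfolding represents_def by simp
  then show ?thesis
    by (rule c1_zero_mfd[OF refl _ real_1_1_flat]) (auto intro!: flat_positive flat_frame)
qed

text \<open>
  On each fibre the total form is \<open>6 a\<^sub>z\<close>, which is Kaehler with constant density, hence Ricci-flat.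
\<close>

lemma ricci_flat_potential_phi:
  "ricci_flat_potential (torus 2 0) disc_mfd (\<lambda>y. torus 1 (y 0)) omega_form phi"
proof -
  interpret X: affine_cover 2 "torus_dom 2" "torus_cover 0" "windows 2" by (rule affine_cover_torus) auto
  interpret Y: affine_cover 1 disc "\<lambda>z. z" "{disc}" by (rule affine_cover_disc)
  have smX: "smooth_fun (torus 2 0) phi"
    by (rule X.smooth_fun_represents[OF trig_poly_phi_lift phi_torus_cover])
  have fib: "smooth_fun (torus 1 (y 0)) phi \<and>
     kahler_form (torus 1 (y 0)) (add_form (restrict_form (torus 2 0) omega_form) (ddc (fun_form phi))) \<and>
     form_eq (torus 1 (y 0)) 2
       (ricci_form (torus 1 (y 0)) (add_form (restrict_form (torus 2 0) omega_form) (ddc (fun_form phi)))) zero_form \<and>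
     form_has_integral (torus 1 (y 0)) (mult_form phi (wedge_power 1 (restrict_form (torus 2 0) omega_form))) 0"
    if y: "y \<in> disc" for y
  proof -
    interpret F: affine_cover 1 "torus_dom 1" "torus_cover (y 0)" "windows 1" by (rule affine_cover_torus) auto
    let ?\<omega> = "restrict_form (torus 2 0) omega_form"
    have rep: "F.represents ?\<omega> (omega (y 0))" by (rule represents_restrict[OF y])
    have tot: "F.represents (add_form ?\<omega> (ddc (fun_form phi))) (flat 6 (-1/3))"
      by (rule represents_total[OF _ _ rep]) auto
    have real: "F.real_1_1 (omega (y 0))" by (rule real_1_1_omega) auto
    have "form_has_integral (torus 1 (y 0)) (mult_form phi (wedge_power 1 ?\<omega>)) 0"
    proof (rule torus_integral_zero)
      let ?R = "\<lambda>s. Re (y 0 * cis s)"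
      let ?g = "\<lambda>s. (- (cmod (y 0))\<^sup>2 / 3 - 2 * ?R s) * (6 - 2 * ?R s)"
      fix U z assume U: "U \<in> windows 1" and z: "z \<in> U"
      have "z \<in> Csp 1" using F.U_Om[OF U] z by (auto simp: torus_dom_def)
      then have z1: "z 1 = 0" by (simp add: Csp_def)
      have "mult_form phi (wedge_power 1 ?\<omega>) (cover_chart (torus_cover (y 0)) U) z (std_frame 1)
          = phi (torus_cover (y 0) z) * omega (y 0) z (cunit 0) (Jop (cunit 0))"
        unfolding mult_form_def F.wedge_power_represents[OF refl rep real U z] F.chart_inv_U[OF U z] ..
      also have "phi (torus_cover (y 0) z) = - (cmod (y 0))\<^sup>2 / 3 - 2 * ?R (Re (z 0))"
        unfolding phi_def torus_cover_simps z1 by simp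
      also have "omega (y 0) z (cunit 0) (Jop (cunit 0)) = 6 - 2 * ?R (Re (z 0))"
        unfolding omega_def z1 Jop_apply area_self by (simp add: cunit_def area_def)
      finally show "mult_form phi (wedge_power 1 ?\<omega>) (cover_chart (torus_cover (y 0)) U) z (std_frame 1)
          = ?g (Re (z 0))" .
    next
      show "continuous_on UNIV (\<lambda>s. (- (cmod (y 0))\<^sup>2 / 3 - 2 * Re (y 0 * cis s)) * (6 - 2 * Re (y 0 * cis s)))"
        by (intro continuous_intros) auto
    next
      fix x :: real
      have "cis (x + 2 * pi) = cis x" by (simp add: cis_mult[symmetric])
      then show "(- (cmod (y 0))\<^sup>2 / 3 - 2 * Re (y 0 * cis (x + 2 * pi))) * (6 - 2 * Re (y 0 * cis (x + 2 * pi)))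
        = (- (cmod (y 0))\<^sup>2 / 3 - 2 * Re (y 0 * cis x)) * (6 - 2 * Re (y 0 * cis x))" by simp
    qed (rule integral_potential_zero)
    moreover have "kahler_form (torus 1 (y 0)) (add_form ?\<omega> (ddc (fun_form phi)))"
      by (rule F.kahler_form_represents[OF tot F.real_1_1_flat]) (auto intro!: flat_positive flat_closed)
    moreover have "form_eq (torus 1 (y 0)) 2 (ricci_form (torus 1 (y 0)) (add_form ?\<omega> (ddc (fun_form phi)))) zero_form"
      by (rule F.ricci_form_constant[OF refl tot F.real_1_1_flat]) (rule flat_frame)
    moreover have "smooth_fun (torus 1 (y 0)) phi"
      by (rule F.smooth_fun_represents[OF trig_poly_phi_lift phi_torus_cover])
    ultimately show ?thesis by blast
  qed
  have dim: "mdim (torus 1 c) = 1" for c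
    using affine_cover.mfd_simps(2)[OF affine_cover_torus[of 1 c]] by simp
  show ?thesis
    unfolding ricci_flat_potential_def Let_def dim Y.mfd_simps topspace_euclidean_subtopology image_ident
    using smX fib by blast
qed

lemma not_semipositive_total:
  "\<not> semipositive_form (torus 2 0) (add_form omega_form (ddc (fun_form phi)))"
proof -
  interpret X: affine_cover 2 "torus_dom 2" "torus_cover 0" "windows 2" by (rule affine_cover_torus) auto
  have "X.represents omega_form (omega 0)" by (simp add: X.represents_def)
  then have rep: "X.represents (add_form omega_form (ddc (fun_form phi))) (flat 6 (-1/3))"
    by (rule represents_total[rotated 2]) auto
  have U: "window 2 0 0 \<in> windows 2" by (auto simp: windows_def)
  have z: "(\<lambda>_. 0) \<in> window 2 0 0" by (simp add: window_def torus_dom_def Csp_def)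
  have v: "cunit 1 \<in> Csp 2" by (rule X.cunit_Csp) simp
  have neg: "flat 6 (-1/3) (\<lambda>_. 0) (cunit 1) (Jop (cunit 1)) < 0"
    unfolding flat_def Jop_apply area_self by (simp add: cunit_def)
  show ?thesis
  proof
    assume "semipositive_form (torus 2 0) (add_form omega_form (ddc (fun_form phi)))"
    then have "add_form omega_form (ddc (fun_form phi)) (cover_chart (torus_cover 0) (window 2 0 0)) (\<lambda>_. 0)
        [cunit 1, Jop (cunit 1)] \<ge> 0"
      unfolding semipositive_form_def using U z v by simp
    then show False
      using neg X.representsD[OF rep U z v Csp_Jop[OF v]] by simp
  qed
qed

theorem theorem4:
  shows "\<exists>(X :: cvec cmfd) (Y :: cvec cmfd) (p :: cvec \<Rightarrow> cvec) (F :: cvec \<Rightarrow> cvec cmfd)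
            (\<omega> :: cvec form) (\<theta> :: cvec form).
     kahler_manifold X \<and> kahler_manifold Y \<and>
     smooth_proper_fibration X Y p F \<and>
     (\<forall>y\<in>topspace (mtop Y). c1_zero (F y)) \<and>
     kahler_form X \<omega> \<and>
     relative_ricci_flat_metric X Y F \<omega> \<theta> \<and>
     \<not> semipositive_form X \<theta>"
proof (intro exI conjI)
  show "kahler_manifold (torus 2 0)"
    unfolding kahler_manifold_def
    using affine_cover.complex_manifold_mfd[OF affine_cover_torus[of 2 0]] kahler_omega by auto
  show "kahler_manifold disc_mfd" by (rule kahler_disc)
  show "smooth_proper_fibration (torus 2 0) disc_mfd base_proj (\<lambda>y. torus 1 (y 0))"
    by (rule fibration_example)
  show "\<forall>y\<in>topspace (mtop disc_mfd). c1_zero (torus 1 (y 0))" using c1_zero_torus by blast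
  show "kahler_form (torus 2 0) omega_form" by (rule kahler_omega)
  show "relative_ricci_flat_metric (torus 2 0) disc_mfd (\<lambda>y. torus 1 (y 0)) omega_form
      (add_form omega_form (ddc (fun_form phi)))"
    unfolding relative_ricci_flat_metric_def using ricci_flat_potential_phi by blast
  show "\<not> semipositive_form (torus 2 0) (add_form omega_form (ddc (fun_form phi)))"
    by (rule not_semipositive_total)
qed

end
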